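(* Let $(\mathcal X,\rho)$ be a Polish space and $\mu\in P_2(\mathcal X)$. If $\mu$ satisfies $\mathbf{LSI}^+(C)$, then $\mu$ satisfies $\mathbf T_2(C)$.
   Context: $|\nabla^-f|(x)=\limsup_{y\to x}[f(y)-f(x)]_+/\rho(x,y)$ with $[a]_+=\max(a,0)$ (and $0$ at isolated points). $\mu$ satisfies $\mathbf{LSI}^+(C)$ if $\mathrm{Ent}_\mu(f^2)\le C\int|\nabla^-f|^2d\mu$ for all locally Lipschitz $f$, where $\mathrm{Ent}_\mu(g)=\int g\log g\,d\mu-\int g\,d\mu\log\int g\,d\mu$. $\mathcal T_2(\nu,\mu)=\inf_\pi\int\rho(x,y)^2d\pi$ over couplings; $H(\nu\,|\,\mu)=\int\log\frac{d\nu}{d\mu}d\nu$ if $\nu\ll\mu$, else $+\infty$; $\mathbf T_2(C)$ means $\mathcal T_2(\nu,\mu)\le C\,H(\nu\,|\,\mu)$ for all $\nu$. *)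

theory Defs
  imports "HOL-Probability.Probability"
begin

definition desc_slope :: "('a::metric_space \<Rightarrow> real) \<Rightarrow> 'a \<Rightarrow> real" where
  "desc_slope f x =
     (if x islimpt (UNIV :: 'a set)
      then real_of_ereal (Limsup (at x) (\<lambda>y. ereal (max (f y - f x) 0 / dist x y)))
      else 0)"

definition locally_lipschitz :: "('a::metric_space \<Rightarrow> real) \<Rightarrow> bool" where
  "locally_lipschitz f \<longleftrightarrow> (\<forall>x. \<exists>e>0. \<exists>L. L-lipschitz_on (ball x e) f)"

definition Ent :: "'a measure \<Rightarrow> ('a \<Rightarrow> real) \<Rightarrow> real" where
  "Ent \<mu> g = (\<integral>x. g x * ln (g x) \<partial>\<mu>) - (\<integral>x. g x \<partial>\<mu>) * ln (\<integral>x. g x \<partial>\<mu>)"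

definition P2 :: "'a::metric_space measure \<Rightarrow> bool" where
  "P2 \<mu> \<longleftrightarrow> prob_space \<mu> \<and> sets \<mu> = sets borel \<and>
     (\<exists>x0. (\<integral>\<^sup>+ x. ennreal ((dist x0 x)\<^sup>2) \<partial>\<mu>) < \<infinity>)"

definition LSI_plus :: "'a::metric_space measure \<Rightarrow> real \<Rightarrow> bool" where
  "LSI_plus \<mu> C \<longleftrightarrow>
     (\<forall>f. locally_lipschitz f \<longrightarrow>
        integrable \<mu> (\<lambda>x. (f x)\<^sup>2) \<longrightarrow>
        integrable \<mu> (\<lambda>x. (f x)\<^sup>2 * ln ((f x)\<^sup>2)) \<longrightarrow>
        ennreal (Ent \<mu> (\<lambda>x. (f x)\<^sup>2)) \<le>
          ennreal C * (\<integral>\<^sup>+ x. ennreal ((desc_slope f x)\<^sup>2) \<partial>\<mu>))"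

definition couplings :: "'a::metric_space measure \<Rightarrow> 'a measure \<Rightarrow> ('a \<times> 'a) measure set" where
  "couplings \<nu> \<mu> = {\<pi>. prob_space \<pi> \<and> sets \<pi> = sets borel \<and>
        distr \<pi> borel fst = \<nu> \<and> distr \<pi> borel snd = \<mu>}"

definition W2sq :: "'a::metric_space measure \<Rightarrow> 'a measure \<Rightarrow> ennreal" where
  "W2sq \<nu> \<mu> = (INF \<pi>\<in>couplings \<nu> \<mu>. \<integral>\<^sup>+ p. ennreal ((dist (fst p) (snd p))\<^sup>2) \<partial>\<pi>)"

text \<open>Relative entropy H(nu | mu); +infinity if nu is not absolutely continuous w.r.t. mu
  or if log(d nu / d mu) is not nu-integrable (its negative part is always integrable).\<close>
definition rel_entropy :: "'a measure \<Rightarrow> 'a measure \<Rightarrow> ennreal" where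
  "rel_entropy \<nu> \<mu> =
     (if absolutely_continuous \<mu> \<nu> \<and> integrable \<nu> (\<lambda>x. ln (enn2real (RN_deriv \<mu> \<nu> x)))
      then ennreal (\<integral>x. ln (enn2real (RN_deriv \<mu> \<nu> x)) \<partial>\<nu>)
      else \<infinity>)"

definition T2 :: "'a::metric_space measure \<Rightarrow> real \<Rightarrow> bool" where
  "T2 \<mu> C \<longleftrightarrow> (\<forall>\<nu>. prob_space \<nu> \<and> sets \<nu> = sets borel \<longrightarrow>
                    W2sq \<nu> \<mu> \<le> ennreal C * rel_entropy \<nu> \<mu>)"

end

theory Submission
  imports Defs
begin

text \<open>
  By the Donsker--Varadhan inequality it suffices to bound exponential integrals of infimum
  convolutions \<open>Q f x = inf\<^sub>y f y + \<rho>(x,y)\<^sup>2\<close>, once a form of Kantorovich duality is available.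
  Discretise \<open>f\<close>: it takes the value \<open>v\<^sub>j\<close> on the cell \<open>A\<^sub>j\<close> of a finite partition, so that
  \<open>w\<^sub>t = min\<^sub>j (t v\<^sub>j + D\<^sub>j\<^sup>2) / C\<close> with \<open>D\<^sub>j\<close> the distance to \<open>A\<^sub>j\<close>. If \<open>j\<close> is a minimising index at \<open>x\<close>,
  the slope of \<open>exp (w\<^sub>t / 2)\<close> at \<open>x\<close> is at most \<open>exp (w\<^sub>t / 2) D\<^sub>j / C\<close>, and since
  \<open>D\<^sub>j\<^sup>2 / C = w\<^sub>t - t v\<^sub>j / C\<close>, the log-Sobolev inequality for \<open>exp (w\<^sub>t / 2)\<close> becomes
  \<open>t \<integral> (v\<^sub>j / C) exp w\<^sub>t d\<mu> \<le> Z ln Z\<close> with \<open>Z = \<integral> exp w\<^sub>t d\<mu>\<close>. As \<open>w\<^sub>t\<close> is concave in \<open>t\<close> with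
  supergradient \<open>v\<^sub>j / C\<close>, this says that \<open>ln Z / t\<close> is nonincreasing; comparing \<open>t = 1\<close> with
  \<open>t \<rightarrow> 0\<close> gives \<open>ln \<integral> exp w\<^sub>1 d\<mu> \<le> \<integral> f d\<mu> / C\<close>.

  The remaining transport problem, from \<open>\<nu>\<close> to the finitely many cells, is solved by entropic
  regularisation: the minimum is replaced by a soft minimum, the regularised dual functional attains
  its maximum on a compact box, and the softmin weights at a maximiser are an almost optimal plan with
  the exact marginals, which spreads to a coupling of \<open>\<nu>\<close> and \<open>\<mu>\<close> since the cells are small.
\<close>

section \<open>Exponential integrals of infimum convolutions\<close>

text \<open>\<open>D j\<close> is kept abstract instead of being the distance to a set, so that an
  index may carry \<open>D j = 0\<close> or a truncated distance, as the applications below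
  require.\<close>

definition hopf_lax :: "nat set \<Rightarrow> (nat \<Rightarrow> 'a \<Rightarrow> real) \<Rightarrow> (nat \<Rightarrow> real) \<Rightarrow> 'a \<Rightarrow> real" where
  "hopf_lax J D u x = (MIN j\<in>J. u j + (D j x)\<^sup>2)"

lemma hopf_lax_le: "finite J \<Longrightarrow> j \<in> J \<Longrightarrow> hopf_lax J D u x \<le> u j + (D j x)\<^sup>2"
  unfolding hopf_lax_def by (intro Min_le) auto

lemma hopf_lax_attained:
  assumes "finite J" "J \<noteq> {}"
  shows "\<exists>j\<in>J. hopf_lax J D u x = u j + (D j x)\<^sup>2"
proof -
  have "hopf_lax J D u x \<in> (\<lambda>j. u j + (D j x)\<^sup>2) ` J"
    unfolding hopf_lax_def using assms by (intro Min_in) auto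
  then show ?thesis by auto
qed

text \<open>The bound on \<open>w\<close> is attained at \<open>y = x\<close>, and
  \<open>(D y)\<^sup>2 - (D x)\<^sup>2 \<le> r * (2 * D x + r)\<close> for
  \<open>r = dist x y\<close>, so the difference quotients of \<open>exp (w / 2)\<close> are
  dominated by those of a smooth function of \<open>r\<close> alone. An upper bound on
  \<open>w\<close> suffices because the slope only sees increases. Nonnegativity is included so that
  the estimate can be squared.\<close>

lemma desc_slope_exp_bounds:
  fixes w D :: "'a::metric_space \<Rightarrow> real"
  assumes C: "C > 0" and D: "\<And>y. 0 \<le> D y" "\<And>y. D y \<le> D x + dist x y"
    and w: "\<And>y. w y \<le> w x + ((D y)\<^sup>2 - (D x)\<^sup>2) / C"
  shows "0 \<le> desc_slope (\<lambda>x. exp (w x / 2)) x \<and>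
    desc_slope (\<lambda>x. exp (w x / 2)) x \<le> exp (w x / 2) * D x / C"
proof (cases "x islimpt (UNIV :: 'a set)")
  case False
  then show ?thesis using C D by (simp add: desc_slope_def)
next
  case True
  then have nt: "at x \<noteq> bot" by (simp add: trivial_limit_within)
  define q where "q = (\<lambda>y. max (exp (w y / 2) - exp (w x / 2)) 0 / dist x y)"
  \<comment> \<open>The difference quotient at \<open>r = 0\<close> of the dominating exponential;
    it tends to the derivative \<open>D x / C\<close>, times the prefactor.\<close>
  define G where "G = (\<lambda>r::real. exp (w x / 2) * ((exp (r * (2 * D x + r) / (2*C)) - 1) / r))"
  have "((\<lambda>r. exp (r * (2 * D x + r) / (2*C))) has_real_derivative D x / C) (at 0)"
    using C by (auto intro!: derivative_eq_intros simp: field_simps)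
  then have "((\<lambda>r. (exp (r * (2 * D x + r) / (2*C)) - 1) / r) \<longlongrightarrow> D x / C) (at 0)"
    by (simp add: DERIV_def)
  then have "((\<lambda>r. (exp (r * (2 * D x + r) / (2*C)) - 1) / r) \<longlongrightarrow> D x / C) (at_right 0)"
    by (rule tendsto_mono[rotated]) (simp add: at_le)
  then have G: "(G \<longlongrightarrow> exp (w x / 2) * (D x / C)) (at_right 0)"
    unfolding G_def by (rule tendsto_mult_left)
  have "((\<lambda>y. dist x y) \<longlongrightarrow> dist x x) (at x)" by (intro tendsto_intros)
  then have "filterlim (\<lambda>y. dist x y) (at_right 0) (at x)"
    by (auto simp: filterlim_at eventually_at_filter)
  from filterlim_compose[OF G this]
  have lim: "((\<lambda>y. ereal (G (dist x y))) \<longlongrightarrow> ereal (exp (w x / 2) * D x / C)) (at x)"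
    by (intro tendsto_intros) simp
  have le: "q y \<le> G (dist x y)" if "y \<noteq> x" for y
  proof -
    have d: "dist x y > 0" using that by auto
    have "(D y)\<^sup>2 \<le> (D x + dist x y)\<^sup>2" using D by (intro power_mono) auto
    then have "(D y)\<^sup>2 - (D x)\<^sup>2 \<le> dist x y * (2 * D x + dist x y)"
      by (simp add: power2_eq_square algebra_simps)
    then have "w y \<le> w x + dist x y * (2 * D x + dist x y) / C"
      using w[of y] divide_right_mono[of "(D y)\<^sup>2 - (D x)\<^sup>2" "dist x y * (2 * D x + dist x y)" C] C
      by linarith
    then have "w y / 2 \<le> w x / 2 + dist x y * (2 * D x + dist x y) / (2*C)" by simp
    then have "exp (w y / 2) \<le> exp (w x / 2) * exp (dist x y * (2 * D x + dist x y) / (2*C))"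
      by (simp flip: exp_add)
    moreover have "1 \<le> exp (dist x y * (2 * D x + dist x y) / (2*C))"
      using C D d by simp
    moreover have "max (a - b) 0 \<le> b * (e - 1)" if "a \<le> b * e" "1 \<le> e" "0 \<le> b" for a b e :: real
      using that mult_left_mono[of 1 e b] by (auto simp: right_diff_distrib)
    ultimately have "max (exp (w y / 2) - exp (w x / 2)) 0
        \<le> exp (w x / 2) * (exp (dist x y * (2 * D x + dist x y) / (2*C)) - 1)"
      by simp
    then show ?thesis unfolding q_def G_def times_divide_eq_right
      using d by (intro divide_right_mono) auto
  qed
  have "Limsup (at x) (\<lambda>y. ereal (q y)) \<le> Limsup (at x) (\<lambda>y. ereal (G (dist x y)))"
    using le by (intro Limsup_mono) (auto simp: eventually_at_filter)
  then have u: "Limsup (at x) (\<lambda>y. ereal (q y)) \<le> ereal (exp (w x / 2) * D x / C)"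
    using lim_imp_Limsup[OF nt lim] by simp
  have l: "0 \<le> Limsup (at x) (\<lambda>y. ereal (q y))"
    by (rule le_Limsup[OF nt]) (auto simp: q_def)
  have "desc_slope (\<lambda>x. exp (w x / 2)) x = real_of_ereal (Limsup (at x) (\<lambda>y. ereal (q y)))"
    using True by (simp add: desc_slope_def q_def)
  \<comment> \<open>\<open>real_of_ereal\<close> sends infinite values to 0, but the two bounds
    force the limsup to be finite and so pass to its real value.\<close>
  moreover have "0 \<le> real_of_ereal L \<and> real_of_ereal L \<le> b" if "L \<le> ereal b" "0 \<le> L" for L b
    using that by (cases L) auto
  ultimately show ?thesis using u l by metis
qed

text \<open>The functions \<open>D j\<close> may be unbounded; it is \<open>cover\<close> that makes
  the infimum convolution essentially bounded and all exponential integrals finite.\<close>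

locale hopf_lax_lsi =
  fixes \<mu> :: "'a::metric_space measure" and C :: real
    and J :: "nat set" and D :: "nat \<Rightarrow> 'a \<Rightarrow> real"
  assumes prob: "prob_space \<mu>" and sets_eq: "sets \<mu> = sets borel"
    and C: "C > 0" and lsi: "LSI_plus \<mu> C"
    and J: "finite J" "J \<noteq> {}"
    and D_nonneg: "\<And>j x. j \<in> J \<Longrightarrow> 0 \<le> D j x"
    and D_lip: "\<And>j x y. j \<in> J \<Longrightarrow> D j y \<le> D j x + dist x y"
    and cover: "AE x in \<mu>. \<exists>j\<in>J. D j x = 0"
begin

section \<open>Measurability, selection of a minimiser and local Lipschitz regularity\<close>

lemma continuous_D: "j \<in> J \<Longrightarrow> continuous_on UNIV (D j)"
proof (rule lipschitz_on_continuous_on[OF lipschitz_onI[of _ _ 1]])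
  fix x y assume "j \<in> J"
  then show "dist (D j x) (D j y) \<le> 1 * dist x y"
    using D_lip[of j x y] D_lip[of j y x] by (simp add: dist_real_def dist_commute abs_le_iff)
qed simp

lemma borel_measurable_D: "j \<in> J \<Longrightarrow> D j \<in> borel_measurable \<mu>"
  using borel_measurable_continuous_onI[OF continuous_D] by (simp add: measurable_cong_sets[OF sets_eq refl])

lemma measurable_hopf_lax [measurable]: "hopf_lax J D u \<in> borel_measurable \<mu>"
  unfolding hopf_lax_def
proof (rule borel_measurable_Min[OF J(1)])
  fix j assume "j \<in> J"
  note [measurable] = borel_measurable_D[OF this]
  show "(\<lambda>x. u j + (D j x)\<^sup>2) \<in> borel_measurable \<mu>" by measurable
qed

text \<open>Taking the least minimising index gives a measurable selection. For
  \<open>u = (\<lambda>j. t * v j)\<close> the number \<open>v (sel u x)\<close> is a supergradient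
  in \<open>t\<close> of the infimum convolution at \<open>x\<close>.\<close>

definition sel :: "(nat \<Rightarrow> real) \<Rightarrow> 'a \<Rightarrow> nat" where
  "sel u x = (LEAST j. j \<in> J \<and> hopf_lax J D u x = u j + (D j x)\<^sup>2)"

lemma sel: "sel u x \<in> J" "hopf_lax J D u x = u (sel u x) + (D (sel u x) x)\<^sup>2"
proof -
  have "\<exists>j. j \<in> J \<and> hopf_lax J D u x = u j + (D j x)\<^sup>2"
    using hopf_lax_attained[OF J, of D u x] by blast
  from LeastI_ex[OF this, folded sel_def]
  show "sel u x \<in> J" "hopf_lax J D u x = u (sel u x) + (D (sel u x) x)\<^sup>2"
    by (rule conjunct1, rule conjunct2)
qed

lemma measurable_sel [measurable]: "sel u \<in> measurable \<mu> (count_space UNIV)"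
  unfolding sel_def
proof (rule measurable_Least)
  fix j
  show "(\<lambda>x. j \<in> J \<and> hopf_lax J D u x = u j + (D j x)\<^sup>2) \<in> measurable \<mu> (count_space UNIV)"
  proof (cases "j \<in> J")
    case True
    note [measurable] = borel_measurable_D[OF True]
    show ?thesis by measurable
  qed auto
qed

lemma hopf_lax_ge:
  assumes "\<And>j. j \<in> J \<Longrightarrow> U \<le> u j"
  shows "U \<le> hopf_lax J D u x"
  using sel[of u x] assms[of "sel u x"] by (simp add: add_increasing2)

lemma hopf_lax_AE_le:
  assumes "\<And>j. j \<in> J \<Longrightarrow> u j \<le> U"
  shows "AE x in \<mu>. hopf_lax J D u x \<le> U"
  using cover
proof eventually_elim
  case (elim x)
  then obtain j where "j \<in> J" "D j x = 0" by blast
  with hopf_lax_le[OF J(1), of j D u x] assms[of j] show ?case by simp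
qed

text \<open>On a unit ball all \<open>D j\<close> stay below a common \<open>B\<close>, so their
  squares, and hence the minimum, are \<open>2 * B\<close>-Lipschitz there. The minimum is then
  bounded above on the ball, and \<open>exp\<close> has bounded slope on its range.\<close>

lemma locally_lipschitz_hopf_lax: "locally_lipschitz (\<lambda>x. exp (hopf_lax J D u x / C / 2))"
  unfolding locally_lipschitz_def
proof
  fix x
  define B where "B = (\<Sum>j\<in>J. D j x) + 1"
  have DB: "D j y \<le> B" if "j \<in> J" "y \<in> ball x 1" for j y
  proof -
    have "D j x \<le> (\<Sum>j\<in>J. D j x)" using that J D_nonneg by (intro member_le_sum) auto
    then show ?thesis using D_lip[OF that(1), where x=x and y=y] that(2) by (simp add: B_def)
  qed
  have B: "B > 0" unfolding B_def using D_nonneg by (simp add: add_nonneg_pos sum_nonneg)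
  have lip: "hopf_lax J D u y \<le> hopf_lax J D u z + 2 * B * dist y z"
    if yz: "y \<in> ball x 1" "z \<in> ball x 1" for y z
  proof -
    \<comment> \<open>An index optimal at \<open>z\<close> is a competitor at
      \<open>y\<close>.\<close>
    define j where "j = sel u z"
    have j: "j \<in> J" "hopf_lax J D u z = u j + (D j z)\<^sup>2" using sel[of u z] by (auto simp: j_def)
    have "(D j y)\<^sup>2 - (D j z)\<^sup>2 = (D j y - D j z) * (D j y + D j z)"
      by (simp add: power2_eq_square algebra_simps)
    also have "\<dots> \<le> dist y z * (D j y + D j z)"
      using D_lip[OF j(1), of y z] D_nonneg[OF j(1)]
      by (intro mult_right_mono) (auto simp: dist_commute)
    also have "\<dots> \<le> dist y z * (2 * B)"
      using DB[OF j(1) yz(1)] DB[OF j(1) yz(2)] by (intro mult_left_mono) auto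
    finally show ?thesis using hopf_lax_le[OF J(1) j(1), of D u y] j(2) by (simp add: algebra_simps)
  qed
  define E where "E = exp ((hopf_lax J D u x + 2 * B) / C / 2)"
  have x: "x \<in> ball x 1" by simp
  have "((E * (2 * B / C / 2)))-lipschitz_on (ball x 1) (\<lambda>x. exp (hopf_lax J D u x / C / 2))"
  proof (rule lipschitz_onI)
    have *: "exp (hopf_lax J D u y / C / 2) - exp (hopf_lax J D u z / C / 2) \<le> E * (2 * B / C / 2) * dist y z"
      if yz: "y \<in> ball x 1" "z \<in> ball x 1" for y z
    proof -
      define a b where "a = hopf_lax J D u y / C / 2" and "b = hopf_lax J D u z / C / 2"
      have ab: "a - b \<le> 2 * B / C / 2 * dist y z"
      proof -
        have "(hopf_lax J D u y - hopf_lax J D u z) / C / 2 \<le> 2 * B * dist y z / C / 2"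
          using lip[OF yz] C by (intro divide_right_mono) auto
        then show ?thesis by (simp add: a_def b_def diff_divide_distrib)
      qed
      have "B * dist y x \<le> B * 1" using yz(1) B by (intro mult_left_mono) (auto simp: dist_commute)
      then have "hopf_lax J D u y / C / 2 \<le> (hopf_lax J D u x + 2 * B) / C / 2"
        using lip[OF yz(1) x] C by (intro divide_right_mono) linarith+
      then have "exp a \<le> E" by (simp add: E_def a_def)
      \<comment> \<open>Convexity of \<open>exp\<close> bounds the increment by
        \<open>exp a * (a - b)\<close>; exchanging \<open>y\<close> and \<open>z\<close> below
        supplies the other sign.\<close>
      have "1 + (b - a) \<le> exp (b - a)" by (rule exp_ge_add_one_self)
      then have "exp a * (1 - exp (b - a)) \<le> exp a * (a - b)" by (intro mult_left_mono) (linarith, simp)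
      then have "exp a - exp b \<le> exp a * (a - b)"
        by (simp add: exp_diff right_diff_distrib)
      also have "\<dots> \<le> exp a * (2 * B / C / 2 * dist y z)" using ab by (intro mult_left_mono) auto
      also have "\<dots> \<le> E * (2 * B / C / 2 * dist y z)"
        using \<open>exp a \<le> E\<close> B C by (intro mult_right_mono) auto
      finally show ?thesis by (simp add: a_def b_def mult.assoc)
    qed
    fix y z assume "y \<in> ball x 1" "z \<in> ball x 1"
    then show "dist (exp (hopf_lax J D u y / C / 2)) (exp (hopf_lax J D u z / C / 2)) \<le> E * (2 * B / C / 2) * dist y z"
      using *[of y z] *[of z y] by (simp add: dist_real_def dist_commute abs_le_iff)
  qed (use B C in \<open>auto simp: E_def\<close>)
  then show "\<exists>e>0. \<exists>L. L-lipschitz_on (ball x e) (\<lambda>x. exp (hopf_lax J D u x / C / 2))"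
    by (intro exI[of _ 1]) auto
qed

end

section \<open>Two elementary estimates for real functions\<close>

lemma exp_le_quadratic:
  fixes y :: real
  assumes "\<bar>y\<bar> \<le> 1"
  shows "exp y \<le> 1 + y + y\<^sup>2"
proof (cases "y \<ge> 0")
  case True
  then show ?thesis using exp_bound[of y] assms by simp
next
  case False
  have "(1 - y) * (1 + y + y\<^sup>2) = 1 - y ^ 3" by (simp add: algebra_simps power2_eq_square power3_eq_cube)
  moreover have "y ^ 3 \<le> 0" using False by (simp add: power_le_zero_eq)
  ultimately have "1 \<le> (1 - y) * (1 + y + y\<^sup>2)" by simp
  also have "\<dots> \<le> exp (- y) * (1 + y + y\<^sup>2)"
    using exp_ge_add_one_self[of "- y"] assms False
    by (intro mult_right_mono) (auto intro: add_nonneg_nonneg)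
  finally show ?thesis by (simp add: exp_minus field_simps)
qed

text \<open>Over \<open>n\<close> equal steps the errors add up to
  \<open>K * (b - a)\<^sup>2 / n\<close>, which vanishes as \<open>n\<close> grows.
  Differentiability of \<open>\<phi>\<close> is avoided, which suits a minimum of finitely many
  functions.\<close>

lemma nonincreasing_if_quadratic_steps:
  fixes \<phi> :: "real \<Rightarrow> real"
  assumes "a < b" "h > 0"
    and step: "\<And>s t. \<lbrakk>a \<le> s; s < t; t \<le> b; t - s \<le> h\<rbrakk> \<Longrightarrow> \<phi> t \<le> \<phi> s + K * (t - s)\<^sup>2"
  shows "\<phi> b \<le> \<phi> a"
proof -
  have bd: "\<phi> b \<le> \<phi> a + K * (b - a)\<^sup>2 * (1 / real n)" if n: "n > 0" "(b - a) / real n \<le> h" for n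
  proof -
    define d where "d = (b - a) / real n"
    have d: "d > 0" "real n * d = b - a" using n assms by (auto simp: d_def)
    have "\<phi> (a + real k * d) \<le> \<phi> a + real k * (K * d\<^sup>2)" if "k \<le> n" for k
      using that
    proof (induction k)
      case (Suc k)
      have "real (Suc k) * d \<le> real n * d" using Suc.prems d by (intro mult_right_mono) auto
      then have "\<phi> (a + real (Suc k) * d) \<le> \<phi> (a + real k * d) + K * ((a + real (Suc k) * d) - (a + real k * d))\<^sup>2"
        using d n by (intro step) (auto simp: algebra_simps d_def[symmetric])
      with Suc show ?case by (simp add: algebra_simps)
    qed simp
    from this[of n] have "\<phi> b \<le> \<phi> a + real n * (K * d\<^sup>2)" using d by simp
    also have "real n * (K * d\<^sup>2) = K * (b - a)\<^sup>2 * (1 / real n)"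
      using n by (simp add: d_def power2_eq_square field_simps)
    finally show ?thesis .
  qed
  have lim: "(\<lambda>n. \<phi> a + K * (b - a)\<^sup>2 * (1 / real n)) \<longlonglongrightarrow> \<phi> a + K * (b - a)\<^sup>2 * 0"
    by (intro tendsto_intros lim_1_over_n)
  have "eventually (\<lambda>n. n > 0 \<and> (b - a) / real n \<le> h) sequentially"
  proof -
    have "(\<lambda>n. (b - a) * (1 / real n)) \<longlonglongrightarrow> (b - a) * 0"
      by (intro tendsto_intros lim_1_over_n)
    then have "eventually (\<lambda>n. (b - a) * (1 / real n) < h) sequentially"
      using assms by (intro order_tendstoD(2)) auto
    with eventually_gt_at_top[of "0::nat"] show ?thesis by eventually_elim auto
  qed
  then have "eventually (\<lambda>n. \<phi> b \<le> \<phi> a + K * (b - a)\<^sup>2 * (1 / real n)) sequentially"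
    by eventually_elim (use bd in auto)
  from tendsto_lowerbound[OF lim this] show ?thesis by simp
qed

section \<open>Monotonicity of the scaled logarithmic Laplace transform\<close>

context hopf_lax_lsi
begin

lemma abs_le_sum: "j \<in> J \<Longrightarrow> \<bar>u j\<bar> \<le> (\<Sum>j\<in>J. \<bar>u j\<bar>)" for u :: "nat \<Rightarrow> real"
  using J by (intro member_le_sum) auto

text \<open>The lower bound holds everywhere because squares are nonnegative, the upper one only
  where some \<open>D j\<close> vanishes.\<close>

lemma hopf_lax_AE_bounded: "AE x in \<mu>. \<bar>hopf_lax J D u x / C\<bar> \<le> (\<Sum>j\<in>J. \<bar>u j\<bar>) / C"
proof -
  define U where "U = (\<Sum>j\<in>J. \<bar>u j\<bar>)"
  have U: "u j \<le> U" "- U \<le> u j" if "j \<in> J" for j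
    using abs_le_sum[OF that, of u] by (auto simp: U_def)
  have "AE x in \<mu>. hopf_lax J D u x \<le> U" using U by (intro hopf_lax_AE_le)
  then show ?thesis
  proof eventually_elim
    case (elim x)
    moreover have "- U \<le> hopf_lax J D u x" using U by (intro hopf_lax_ge)
    ultimately have "\<bar>hopf_lax J D u x\<bar> \<le> U" by simp
    then show ?case using C by (simp add: U_def divide_right_mono)
  qed
qed

lemma integrable_comp_hopf_lax:
  fixes g :: "'a \<Rightarrow> real"
  assumes [measurable]: "g \<in> borel_measurable \<mu>" and "AE x in \<mu>. \<bar>g x\<bar> \<le> B"
  shows "integrable \<mu> g" "integrable \<mu> (\<lambda>x. exp (hopf_lax J D u x / C) * g x)"
proof -
  interpret prob_space \<mu> by (rule prob)
  show "integrable \<mu> g" using assms by (intro integrable_const_bound[of _ B]) auto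
  show "integrable \<mu> (\<lambda>x. exp (hopf_lax J D u x / C) * g x)"
  proof (rule integrable_const_bound)
    show "AE x in \<mu>. norm (exp (hopf_lax J D u x / C) * g x) \<le> exp ((\<Sum>j\<in>J. \<bar>u j\<bar>) / C) * B"
      using hopf_lax_AE_bounded[of u] assms(2)
    proof eventually_elim
      case (elim x)
      then have "exp (hopf_lax J D u x / C) * \<bar>g x\<bar> \<le> exp ((\<Sum>j\<in>J. \<bar>u j\<bar>) / C) * B"
        using abs_le_D1[OF elim(1)] by (intro mult_mono) auto
      then show ?case by (simp add: abs_mult)
    qed
  qed measurable
qed

lemma integrable_exp_hopf_lax: "integrable \<mu> (\<lambda>x. exp (hopf_lax J D u x / C))"
  using integrable_comp_hopf_lax(2)[of "\<lambda>_. 1" 1] by simp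

definition Z :: "(nat \<Rightarrow> real) \<Rightarrow> real" where
  "Z u = (\<integral>x. exp (hopf_lax J D u x / C) \<partial>\<mu>)"

lemma Z_pos: "Z u > 0"
proof -
  interpret prob_space \<mu> by (rule prob)
  have "(\<integral>x. 0 \<partial>\<mu>) < Z u" unfolding Z_def
    by (rule integral_less_AE_space) (auto simp: integrable_exp_hopf_lax emeasure_space_1)
  then show ?thesis by simp
qed

lemma integrable_sel: "integrable \<mu> (\<lambda>x. exp (hopf_lax J D u x / C) * (v (sel u x) / C))"
proof (rule integrable_comp_hopf_lax(2))
  show "(\<lambda>x. v (sel u x) / C) \<in> borel_measurable \<mu>" by measurable
  show "AE x in \<mu>. \<bar>v (sel u x) / C\<bar> \<le> (\<Sum>j\<in>J. \<bar>v j\<bar>) / C"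
    using abs_le_sum[OF sel(1), of v u] C by (intro AE_I2) (auto simp: divide_right_mono)
qed

text \<open>The entropy of \<open>exp w\<close>, with \<open>w = hopf_lax J D u / C\<close>, is the
  integral of \<open>exp w * w\<close> minus \<open>Z u * ln (Z u)\<close>. The slope bound makes
  the other side of the log-Sobolev inequality at most the integral of
  \<open>exp w * (w - u (sel u x) / C)\<close>, and the terms \<open>exp w * w\<close>
  cancel.\<close>

lemma lsi_hopf_lax:
  "(\<integral>x. exp (hopf_lax J D u x / C) * (u (sel u x) / C) \<partial>\<mu>) \<le> Z u * ln (Z u)"
proof -
  define w where "w = (\<lambda>x. hopf_lax J D u x / C)"
  have [measurable]: "w \<in> borel_measurable \<mu>" unfolding w_def by measurable
  define f where "f = (\<lambda>x. exp (w x / 2))"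
  have f2: "(f x)\<^sup>2 = exp (w x)" for x
    unfolding f_def power2_eq_square by (simp flip: exp_add)
  have iw: "integrable \<mu> (\<lambda>x. exp (w x) * w x)" unfolding w_def
    by (rule integrable_comp_hopf_lax(2)[OF _ hopf_lax_AE_bounded]) measurable
  have iu: "integrable \<mu> (\<lambda>x. exp (w x) * (u (sel u x) / C))"
    using integrable_sel[of u u] by (simp add: w_def)
  \<comment> \<open>Written as a difference, \<open>R\<close> is visibly integrable; by the choice
    of \<open>sel\<close> it equals \<open>C\<close> times the square of the slope bound.\<close>
  define R where "R = (\<lambda>x. exp (w x) * w x - exp (w x) * (u (sel u x) / C))"
  have iR: "integrable \<mu> R" unfolding R_def using iw iu by (rule Bochner_Integration.integrable_diff)
  have R: "R x = exp (w x) * (D (sel u x) x)\<^sup>2 / C" for x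
    unfolding R_def w_def using sel(2)[of u x] C by (simp add: field_simps)
  have slope: "(desc_slope f x)\<^sup>2 \<le> R x / C" for x
  proof -
    have "0 \<le> desc_slope f x \<and> desc_slope f x \<le> exp (w x / 2) * D (sel u x) x / C"
      unfolding f_def
    proof (rule desc_slope_exp_bounds[OF C, where D = "D (sel u x)"])
      fix y
      have "hopf_lax J D u y \<le> hopf_lax J D u x + ((D (sel u x) y)\<^sup>2 - (D (sel u x) x)\<^sup>2)"
        using hopf_lax_le[OF J(1) sel(1), of D u y u x] sel(2)[of u x] by simp
      then show "w y \<le> w x + ((D (sel u x) y)\<^sup>2 - (D (sel u x) x)\<^sup>2) / C"
        unfolding w_def add_divide_distrib[symmetric] using C by (intro divide_right_mono) auto
    qed (use D_nonneg D_lip sel(1) in auto)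
    then have "(desc_slope f x)\<^sup>2 \<le> (exp (w x / 2) * D (sel u x) x / C)\<^sup>2"
      by (intro power_mono) auto
    also have "\<dots> = R x / C"
      using f2[of x] by (simp add: R f_def power_divide power_mult_distrib power2_eq_square)
    finally show ?thesis .
  qed
  have "locally_lipschitz f" unfolding f_def w_def by (rule locally_lipschitz_hopf_lax)
  moreover have "integrable \<mu> (\<lambda>x. (f x)\<^sup>2)"
    unfolding f2 unfolding w_def by (rule integrable_exp_hopf_lax)
  moreover have "integrable \<mu> (\<lambda>x. (f x)\<^sup>2 * ln ((f x)\<^sup>2))"
    unfolding f2 using iw by simp
  ultimately have "ennreal (Ent \<mu> (\<lambda>x. (f x)\<^sup>2)) \<le> ennreal C * (\<integral>\<^sup>+ x. ennreal ((desc_slope f x)\<^sup>2) \<partial>\<mu>)"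
    using lsi unfolding LSI_plus_def by blast
  also have "\<dots> \<le> ennreal C * (\<integral>\<^sup>+ x. ennreal (R x / C) \<partial>\<mu>)"
    using slope by (intro mult_left_mono nn_integral_mono ennreal_leI) auto
  also have "(\<integral>\<^sup>+ x. ennreal (R x / C) \<partial>\<mu>) = ennreal (\<integral>x. R x / C \<partial>\<mu>)"
  proof (rule nn_integral_eq_integral)
    show "integrable \<mu> (\<lambda>x. R x / C)" using iR by simp
    show "AE x in \<mu>. 0 \<le> R x / C" using C by (simp add: R)
  qed
  also have "ennreal C * \<dots> = ennreal (\<integral>x. R x \<partial>\<mu>)"
    using C by (simp flip: ennreal_mult')
  \<comment> \<open>Since the right-hand integral is nonnegative, \<open>ennreal\<close> can be
    removed whatever the sign of the entropy.\<close>
  finally have "Ent \<mu> (\<lambda>x. (f x)\<^sup>2) \<le> (\<integral>x. R x \<partial>\<mu>)"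
  proof (subst (asm) ennreal_le_iff)
    show "0 \<le> (\<integral>x. R x \<partial>\<mu>)" using C by (intro integral_nonneg_AE AE_I2) (simp add: R)
  qed
  moreover have "Ent \<mu> (\<lambda>x. (f x)\<^sup>2) = (\<integral>x. exp (w x) * w x \<partial>\<mu>) - Z u * ln (Z u)"
    unfolding Ent_def f2 Z_def w_def by simp
  moreover have "(\<integral>x. R x \<partial>\<mu>) = (\<integral>x. exp (w x) * w x \<partial>\<mu>) - (\<integral>x. exp (w x) * (u (sel u x) / C) \<partial>\<mu>)"
    unfolding R_def by (rule Bochner_Integration.integral_diff[OF iw iu])
  ultimately show ?thesis by (simp add: w_def)
qed

text \<open>The index selected at scale \<open>s\<close> competes at scale \<open>t\<close>, so the
  exponent grows by at most \<open>(t - s) * c x\<close>. Expanding \<open>exp\<close> to second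
  order, bounding the linear term by \<open>lsi_hopf_lax\<close> and using
  \<open>ln y \<le> y - 1\<close> gives one step with a quadratic error.\<close>

lemma log_Laplace_step:
  assumes st: "0 < s" "s < t" and V: "(\<Sum>j\<in>J. \<bar>v j\<bar>) / C = V" and small: "(t - s) * V \<le> 1"
  shows "ln (Z (\<lambda>j. t * v j)) / t \<le> ln (Z (\<lambda>j. s * v j)) / s + V\<^sup>2 * (t - s)\<^sup>2 / t"
proof -
  interpret prob_space \<mu> by (rule prob)
  define h where "h = t - s"
  have h: "h > 0" using st by (simp add: h_def)
  let ?u = "\<lambda>j. s * v j"
  define c where "c = (\<lambda>x. v (sel ?u x) / C)"
  have cV: "\<bar>c x\<bar> \<le> V" for x
    unfolding c_def V[symmetric] using abs_le_sum[OF sel(1), of v ?u x] C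
    by (auto simp: divide_right_mono)
  have ic: "integrable \<mu> (\<lambda>x. exp (hopf_lax J D ?u x / C) * c x)"
    unfolding c_def by (rule integrable_sel)
  have le: "exp (hopf_lax J D (\<lambda>j. t * v j) x / C)
      \<le> exp (hopf_lax J D ?u x / C) + h * (exp (hopf_lax J D ?u x / C) * c x)
        + V\<^sup>2 * h\<^sup>2 * exp (hopf_lax J D ?u x / C)" for x
  proof -
    have hc: "\<bar>h * c x\<bar> \<le> h * V" using cV[of x] h by (simp add: abs_mult)
    have "hopf_lax J D (\<lambda>j. t * v j) x \<le> hopf_lax J D ?u x + h * v (sel ?u x)"
      using hopf_lax_le[OF J(1) sel(1), of D "\<lambda>j. t * v j" x ?u x] sel(2)[of ?u x]
      by (simp add: h_def algebra_simps)
    then have "hopf_lax J D (\<lambda>j. t * v j) x / C \<le> (hopf_lax J D ?u x + h * v (sel ?u x)) / C"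
      using C by (intro divide_right_mono) auto
    then have "exp (hopf_lax J D (\<lambda>j. t * v j) x / C) \<le> exp (hopf_lax J D ?u x / C) * exp (h * c x)"
      by (simp add: c_def add_divide_distrib flip: exp_add)
    also have "\<dots> \<le> exp (hopf_lax J D ?u x / C) * (1 + h * c x + (h * c x)\<^sup>2)"
      using hc small by (intro mult_left_mono exp_le_quadratic) (auto simp: h_def)
    also have "\<dots> \<le> exp (hopf_lax J D ?u x / C) * (1 + h * c x + (h * V)\<^sup>2)"
      using hc power_mono[OF hc, of 2] by (intro mult_left_mono) auto
    finally show ?thesis by (simp add: algebra_simps)
  qed
  have "Z (\<lambda>j. t * v j) \<le> (\<integral>x. exp (hopf_lax J D ?u x / C) + h * (exp (hopf_lax J D ?u x / C) * c x)
        + V\<^sup>2 * h\<^sup>2 * exp (hopf_lax J D ?u x / C) \<partial>\<mu>)"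
    unfolding Z_def
  proof (rule integral_mono[OF integrable_exp_hopf_lax _ le])
    show "integrable \<mu> (\<lambda>x. exp (hopf_lax J D ?u x / C) + h * (exp (hopf_lax J D ?u x / C) * c x)
        + V\<^sup>2 * h\<^sup>2 * exp (hopf_lax J D ?u x / C))"
      using ic integrable_exp_hopf_lax by (intro Bochner_Integration.integrable_add integrable_mult_right)
  qed
  also have "\<dots> = Z ?u + h * (\<integral>x. exp (hopf_lax J D ?u x / C) * c x \<partial>\<mu>) + V\<^sup>2 * h\<^sup>2 * Z ?u"
    using ic by (simp add: Z_def integrable_exp_hopf_lax)
  \<comment> \<open>Here \<open>lsi_hopf_lax\<close> is applied to the values
    \<open>s * v j\<close>, whence the division by \<open>s\<close>.\<close>
  also have "(\<integral>x. exp (hopf_lax J D ?u x / C) * c x \<partial>\<mu>) \<le> Z ?u * ln (Z ?u) / s"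
  proof -
    have "s * (\<integral>x. exp (hopf_lax J D ?u x / C) * c x \<partial>\<mu>) =
        (\<integral>x. exp (hopf_lax J D ?u x / C) * (?u (sel ?u x) / C) \<partial>\<mu>)"
      unfolding c_def by (subst integral_mult_right_zero[symmetric]) (simp add: algebra_simps)
    also have "\<dots> \<le> Z ?u * ln (Z ?u)" by (rule lsi_hopf_lax)
    finally show ?thesis using st by (simp add: field_simps)
  qed
  finally have "Z (\<lambda>j. t * v j) \<le> Z ?u * (1 + h * ln (Z ?u) / s + V\<^sup>2 * h\<^sup>2)"
    using h by (simp add: algebra_simps)
  then have q: "Z (\<lambda>j. t * v j) / Z ?u \<le> 1 + h * ln (Z ?u) / s + V\<^sup>2 * h\<^sup>2"
    using Z_pos[of ?u] by (simp add: field_simps)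
  have "ln (Z (\<lambda>j. t * v j)) - ln (Z ?u) = ln (Z (\<lambda>j. t * v j) / Z ?u)"
    using Z_pos[of ?u] Z_pos[of "\<lambda>j. t * v j"] by (simp add: ln_div)
  also have "\<dots> \<le> Z (\<lambda>j. t * v j) / Z ?u - 1"
    using Z_pos by (intro ln_le_minus_one) auto
  finally have "ln (Z (\<lambda>j. t * v j)) \<le> ln (Z ?u) + h * ln (Z ?u) / s + V\<^sup>2 * h\<^sup>2" using q by simp
  \<comment> \<open>As \<open>h = t - s\<close>, the factor \<open>1 + h / s\<close> is
    \<open>t / s\<close>; this is why \<open>ln Z / t\<close> is the monotone quantity.\<close>
  also have "\<dots> = t * (ln (Z ?u) / s) + V\<^sup>2 * h\<^sup>2"
    using st by (simp add: h_def field_simps)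
  finally have "ln (Z (\<lambda>j. t * v j)) / t \<le> (t * (ln (Z ?u) / s) + V\<^sup>2 * h\<^sup>2) / t"
    using st by (intro divide_right_mono) auto
  then show ?thesis using st by (simp add: add_divide_distrib h_def)
qed

text \<open>The steps above show that \<open>ln Z / t\<close> does not increase from
  \<open>t = e\<close> to \<open>t = 1\<close>. At \<open>t = e\<close> a second-order expansion of
  \<open>exp\<close> bounds it by the mean of \<open>f / C\<close> plus
  \<open>e * V\<^sup>2\<close>, and then \<open>e\<close> tends to 0.\<close>

proposition log_Laplace_hopf_lax_le:
  assumes f: "AE x in \<mu>. \<exists>j\<in>J. D j x = 0 \<and> v j = f x" and [measurable]: "f \<in> borel_measurable \<mu>"
  shows "ln (Z v) \<le> (\<integral>x. f x \<partial>\<mu>) / C"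
proof -
  interpret prob_space \<mu> by (rule prob)
  define V where "V = (\<Sum>j\<in>J. \<bar>v j\<bar>) / C"
  have V0: "V \<ge> 0" unfolding V_def using C by (auto intro!: divide_nonneg_pos sum_nonneg)
  define \<phi> where "\<phi> = (\<lambda>t. ln (Z (\<lambda>j. t * v j)) / t)"
  have f_bound: "AE x in \<mu>. \<bar>f x / C\<bar> \<le> V"
    using f
  proof eventually_elim
    case (elim x)
    then obtain j where "j \<in> J" "v j = f x" by blast
    with abs_le_sum[of j v] C show ?case by (auto simp: V_def intro: divide_right_mono)
  qed
  have int_f: "integrable \<mu> (\<lambda>x. f x / C)"
    by (rule integrable_comp_hopf_lax(1)[OF _ f_bound]) measurable
  have *: "\<phi> 1 \<le> (\<integral>x. f x \<partial>\<mu>) / C + e * V\<^sup>2" if e: "0 < e" "e < 1" "e * V \<le> 1" for e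
  proof -
    \<comment> \<open>The step error carries \<open>1 / t\<close>, which is at most
      \<open>1 / e\<close> here; the mesh \<open>1 / (V + 1)\<close> keeps
      \<open>(t - s) * V \<le> 1\<close> and makes sense also for \<open>V = 0\<close>.\<close>
    have "\<phi> 1 \<le> \<phi> e"
    proof (rule nonincreasing_if_quadratic_steps[where \<phi> = \<phi> and K = "V\<^sup>2 / e" and h = "1 / (V + 1)"])
      show "1 / (V + 1) > 0" using V0 by simp
      fix s t assume st: "e \<le> s" "s < t" "t \<le> 1" "t - s \<le> 1 / (V + 1)"
      have "(t - s) * V \<le> 1 / (V + 1) * V" using st V0 by (intro mult_right_mono) auto
      also have "\<dots> \<le> 1" using V0 by (simp add: field_simps)
      finally have "\<phi> t \<le> \<phi> s + V\<^sup>2 * (t - s)\<^sup>2 / t"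
        unfolding \<phi>_def using st e by (intro log_Laplace_step) (auto simp: V_def)
      also have "V\<^sup>2 * (t - s)\<^sup>2 / t \<le> V\<^sup>2 * (t - s)\<^sup>2 / e"
        using st e by (intro divide_left_mono) auto
      finally show "\<phi> t \<le> \<phi> s + V\<^sup>2 / e * (t - s)\<^sup>2" by simp
    qed (use e in auto)
    also have "\<phi> e \<le> (\<integral>x. f x \<partial>\<mu>) / C + e * V\<^sup>2"
    proof -
      have "Z (\<lambda>j. e * v j) \<le> (\<integral>x. 1 + e * (f x / C) + e\<^sup>2 * V\<^sup>2 \<partial>\<mu>)"
        unfolding Z_def
      proof (rule integral_mono_AE[OF integrable_exp_hopf_lax])
        show "AE x in \<mu>. exp (hopf_lax J D (\<lambda>j. e * v j) x / C) \<le> 1 + e * (f x / C) + e\<^sup>2 * V\<^sup>2"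
          using f f_bound
        proof eventually_elim
          case (elim x)
          then obtain j where "j \<in> J" "D j x = 0" "v j = f x" by blast
          \<comment> \<open>The index with \<open>D j x = 0\<close> bounds the minimum by
            \<open>e * f x\<close>.\<close>
          then have "hopf_lax J D (\<lambda>j. e * v j) x / C \<le> e * (f x / C)"
            using hopf_lax_le[OF J(1), of j D "\<lambda>j. e * v j" x] C by (simp add: divide_right_mono)
          then have "exp (hopf_lax J D (\<lambda>j. e * v j) x / C) \<le> exp (e * (f x / C))" by simp
          also have b: "\<bar>e * (f x / C)\<bar> \<le> e * V"
            unfolding abs_mult using elim e by (intro mult_mono) auto
          then have "exp (e * (f x / C)) \<le> 1 + e * (f x / C) + (e * (f x / C))\<^sup>2"
            using e by (intro exp_le_quadratic) auto
          also have "(e * (f x / C))\<^sup>2 \<le> (e * V)\<^sup>2"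
            using b by (rule power2_le_iff_abs_le[THEN iffD2, rotated]) (use e V0 in simp)
          finally show ?case by (simp add: power_mult_distrib)
        qed
        show "integrable \<mu> (\<lambda>x. 1 + e * (f x / C) + e\<^sup>2 * V\<^sup>2)"
          by (intro Bochner_Integration.integrable_add integrable_mult_right int_f) auto
      qed
      also have "\<dots> = 1 + e * (\<integral>x. f x / C \<partial>\<mu>) + e\<^sup>2 * V\<^sup>2"
      proof -
        have "(\<integral>x. 1 + e * g x + e\<^sup>2 * V\<^sup>2 \<partial>\<mu>) = 1 + e * (\<integral>x. g x \<partial>\<mu>) + e\<^sup>2 * V\<^sup>2"
          if "integrable \<mu> g" for g
          using that by (simp add: prob_space)
        from this[OF int_f] show ?thesis .
      qed
      finally have "Z (\<lambda>j. e * v j) - 1 \<le> e * ((\<integral>x. f x \<partial>\<mu>) / C) + e\<^sup>2 * V\<^sup>2" by simp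
      then have "ln (Z (\<lambda>j. e * v j)) \<le> e * ((\<integral>x. f x \<partial>\<mu>) / C) + e\<^sup>2 * V\<^sup>2"
        using ln_le_minus_one[OF Z_pos[of "\<lambda>j. e * v j"]] by simp
      then have "\<phi> e \<le> (e * ((\<integral>x. f x \<partial>\<mu>) / C) + e\<^sup>2 * V\<^sup>2) / e"
        unfolding \<phi>_def using e by (intro divide_right_mono) auto
      then show ?thesis using e by (simp add: add_divide_distrib power2_eq_square)
    qed
    finally show ?thesis .
  qed
  have lim: "((\<lambda>e. (\<integral>x. f x \<partial>\<mu>) / C + e * V\<^sup>2) \<longlongrightarrow> (\<integral>x. f x \<partial>\<mu>) / C + 0 * V\<^sup>2) (at_right 0)"
    by (intro tendsto_intros)
  have "eventually (\<lambda>e. e \<in> {0<..<1 / (V + 1)}) (at_right (0::real))"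
    using V0 by (intro eventually_at_right_real) auto
  then have "eventually (\<lambda>e. \<phi> 1 \<le> (\<integral>x. f x \<partial>\<mu>) / C + e * V\<^sup>2) (at_right 0)"
  proof eventually_elim
    case (elim e)
    then have "e * (V + 1) < 1" "0 < e" using V0 by (auto simp: field_simps)
    moreover have "0 \<le> e * V" using elim V0 by auto
    ultimately show ?case using * by (auto simp: algebra_simps)
  qed
  from tendsto_lowerbound[OF lim this] show ?thesis by (simp add: \<phi>_def)
qed

end

section \<open>Relative entropy\<close>

text \<open>Jensen's inequality for \<open>exp\<close> under \<open>\<nu>\<close>, applied to
  \<open>k = w - ln h\<close> with \<open>h\<close> the density: multiplying \<open>exp k\<close> by
  \<open>h\<close> gives at most \<open>exp w\<close>, which turns the \<open>\<nu>\<close>-integral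
  into a \<open>\<mu>\<close>-integral.\<close>

lemma Donsker_Varadhan_le:
  assumes "prob_space \<mu>" "prob_space \<nu>" and sets_eq: "sets \<nu> = sets \<mu>"
    and ac: "absolutely_continuous \<mu> \<nu>"
    and int_ln: "integrable \<nu> (\<lambda>x. ln (enn2real (RN_deriv \<mu> \<nu> x)))"
    and w[measurable]: "w \<in> borel_measurable \<mu>" and bound: "AE x in \<mu>. \<bar>w x\<bar> \<le> B"
  shows "(\<integral>x. w x \<partial>\<nu>) \<le> (\<integral>x. ln (enn2real (RN_deriv \<mu> \<nu> x)) \<partial>\<nu>) + ln (\<integral>x. exp (w x) \<partial>\<mu>)"
proof -
  interpret \<mu>: prob_space \<mu> by fact
  interpret \<nu>: prob_space \<nu> by fact
  define h where "h = (\<lambda>x. enn2real (RN_deriv \<mu> \<nu> x))"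
  have [measurable]: "h \<in> borel_measurable \<mu>" unfolding h_def by measurable
  have dens: "density \<mu> (RN_deriv \<mu> \<nu>) = \<nu>" using ac sets_eq by (rule \<mu>.density_RN_deriv)
  have fin: "AE x in \<mu>. RN_deriv \<mu> \<nu> x \<noteq> \<infinity>"
    using \<mu>.RN_deriv_finite[OF _ ac sets_eq] \<nu>.sigma_finite_measure_axioms by blast
  have w\<nu>[measurable]: "w \<in> borel_measurable \<nu>" using w by (simp add: measurable_cong_sets[OF sets_eq refl])
  have h\<nu>[measurable]: "h \<in> borel_measurable \<nu>" unfolding measurable_cong_sets[OF sets_eq refl] by measurable
  have bound\<nu>: "AE x in \<nu>. \<bar>w x\<bar> \<le> B"
    using bound ac sets_eq by (intro absolutely_continuous_AE[of \<nu> \<mu>]) auto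
  have int_w: "integrable \<nu> w" using bound\<nu> by (intro \<nu>.integrable_const_bound[of _ B]) auto
  have int_exp: "integrable \<mu> (\<lambda>x. exp (w x))"
    using bound by (intro \<mu>.integrable_const_bound[of _ "exp B"]) (auto elim!: eventually_mono)
  define k where "k = (\<lambda>x. w x - ln (h x))"
  have [measurable]: "k \<in> borel_measurable \<mu>" unfolding k_def by measurable
  have int_k: "integrable \<nu> k" using int_w int_ln by (simp add: k_def h_def)
  define m where "m = (\<integral>x. k x \<partial>\<nu>)"
  \<comment> \<open>The change of measure is made for nonnegative integrals, so that integrability
    of \<open>exp (k x - m)\<close> comes out as a consequence.\<close>
  have "(\<integral>\<^sup>+ x. ennreal (exp (k x - m)) \<partial>\<nu>) = (\<integral>\<^sup>+ x. RN_deriv \<mu> \<nu> x * ennreal (exp (k x - m)) \<partial>\<mu>)"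
    by (subst dens[symmetric], subst nn_integral_density) auto
  also have "\<dots> \<le> (\<integral>\<^sup>+ x. ennreal (exp (- m) * exp (w x)) \<partial>\<mu>)"
  proof (rule nn_integral_mono_AE)
    show "AE x in \<mu>. RN_deriv \<mu> \<nu> x * ennreal (exp (k x - m)) \<le> ennreal (exp (- m) * exp (w x))"
      using fin
    proof eventually_elim
      case (elim x)
      have h: "h x \<ge> 0" by (simp add: h_def)
      \<comment> \<open>Equality holds where the density is positive; where it vanishes the left
        side is 0.\<close>
      have "h x * exp (k x - m) \<le> exp (- m) * exp (w x)"
      proof (cases "h x = 0")
        case False
        then have "exp (ln (h x)) = h x" using h by simp
        then have "exp (k x - m) = exp (- m) * exp (w x) / h x"
          by (simp add: k_def exp_diff exp_minus divide_inverse mult_ac)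
        then show ?thesis using False by simp
      qed simp
      moreover have "RN_deriv \<mu> \<nu> x = ennreal (h x)"
        using elim by (simp add: h_def less_top)
      ultimately show ?case using h by (simp flip: ennreal_mult)
    qed
  qed
  also have "\<dots> = ennreal (exp (- m) * (\<integral>x. exp (w x) \<partial>\<mu>))"
    using int_exp by (subst nn_integral_eq_integral) auto
  finally have le: "(\<integral>\<^sup>+ x. ennreal (exp (k x - m)) \<partial>\<nu>) \<le> ennreal (exp (- m) * (\<integral>x. exp (w x) \<partial>\<mu>))" .
  have meas: "(\<lambda>x. exp (k x - m)) \<in> borel_measurable \<nu>" unfolding k_def by measurable
  have int: "integrable \<nu> (\<lambda>x. exp (k x - m))"
    using meas le by (intro integrableI_bounded) (auto simp: le_less_trans)
  \<comment> \<open>Jensen's inequality by way of the tangent of \<open>exp\<close> at 0;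
    \<open>m\<close> is the mean of \<open>k\<close>.\<close>
  have "1 = (\<integral>x. 1 + (k x - m) \<partial>\<nu>)"
    using int_k by (simp add: m_def \<nu>.prob_space)
  also have "\<dots> \<le> (\<integral>x. exp (k x - m) \<partial>\<nu>)"
    using int_k int by (intro integral_mono) auto
  also have "\<dots> \<le> exp (- m) * (\<integral>x. exp (w x) \<partial>\<mu>)"
    using le by (subst (asm) nn_integral_eq_integral[OF int]) (auto simp: integral_nonneg_AE)
  finally have "exp m \<le> (\<integral>x. exp (w x) \<partial>\<mu>)"
    by (simp add: exp_minus field_simps)
  then have "ln (exp m) \<le> ln (\<integral>x. exp (w x) \<partial>\<mu>)"
    by (subst ln_le_cancel_iff) (auto intro: less_le_trans[OF exp_gt_zero])
  moreover have "m = (\<integral>x. w x \<partial>\<nu>) - (\<integral>x. ln (h x) \<partial>\<nu>)"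
    unfolding m_def k_def using int_w int_ln by (simp add: h_def)
  ultimately show ?thesis by (simp add: h_def)
qed

lemma (in hopf_lax_lsi) integrable_hopf_lax:
  assumes "prob_space \<nu>" "sets \<nu> = sets borel" and ac: "absolutely_continuous \<mu> \<nu>"
  shows "integrable \<nu> (hopf_lax J D v)"
proof -
  interpret \<nu>: prob_space \<nu> by fact
  have eq: "sets \<nu> = sets \<mu>" using assms sets_eq by simp
  have "AE x in \<nu>. \<bar>hopf_lax J D v x / C\<bar> \<le> (\<Sum>j\<in>J. \<bar>v j\<bar>) / C"
    using hopf_lax_AE_bounded ac eq by (intro absolutely_continuous_AE[of \<nu> \<mu>]) auto
  then have "integrable \<nu> (\<lambda>x. hopf_lax J D v x / C)"
    using measurable_hopf_lax eq by (intro \<nu>.integrable_const_bound) (auto simp: measurable_cong_sets[OF eq refl])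
  then have "integrable \<nu> (\<lambda>x. C * (hopf_lax J D v x / C))" by (rule integrable_mult_right)
  then show ?thesis using C by simp
qed

text \<open>This bounds the Kantorovich dual functional by \<open>C\<close> times the entropy. It is
  used twice: for the second moment of \<open>\<nu>\<close> and for the semi-discrete transport
  problem.\<close>

lemma (in hopf_lax_lsi) integral_hopf_lax_le:
  assumes "prob_space \<nu>" "sets \<nu> = sets borel" and ac: "absolutely_continuous \<mu> \<nu>"
    and int_ln: "integrable \<nu> (\<lambda>x. ln (enn2real (RN_deriv \<mu> \<nu> x)))"
    and f: "AE x in \<mu>. \<exists>j\<in>J. D j x = 0 \<and> v j = f x" "f \<in> borel_measurable \<mu>"
  shows "(\<integral>x. hopf_lax J D v x \<partial>\<nu>) \<le> C * (\<integral>x. ln (enn2real (RN_deriv \<mu> \<nu> x)) \<partial>\<nu>) + (\<integral>x. f x \<partial>\<mu>)"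
proof -
  have "(\<integral>x. hopf_lax J D v x / C \<partial>\<nu>) \<le> (\<integral>x. ln (enn2real (RN_deriv \<mu> \<nu> x)) \<partial>\<nu>) + ln (\<integral>x. exp (hopf_lax J D v x / C) \<partial>\<mu>)"
    using assms sets_eq prob by (intro Donsker_Varadhan_le[OF _ _ _ _ _ _ hopf_lax_AE_bounded]) auto
  also have "\<dots> \<le> (\<integral>x. ln (enn2real (RN_deriv \<mu> \<nu> x)) \<partial>\<nu>) + (\<integral>x. f x \<partial>\<mu>) / C"
    using log_Laplace_hopf_lax_le[OF f] by (simp add: Z_def)
  finally show ?thesis using C by (simp add: field_simps)
qed

section \<open>Semi-discrete optimal transport\<close>

lemma compact_PiE_UNIV:
  fixes B :: "'i \<Rightarrow> 'a::topological_space set"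
  assumes "\<And>i. compact (B i)"
  shows "compact (PiE UNIV B)"
  using assms by (simp add: compactin_PiE flip: compactin_euclidean_iff euclidean_product_topology)

text \<open>\<open>a j x\<close> is the cost of sending \<open>x\<close> to index \<open>j\<close>
  and \<open>b j\<close> the mass prescribed there. Positive masses make the dual functional
  coercive up to additive constants.\<close>

locale entropic_dual =
  fixes \<nu> :: "'a measure" and J :: "nat set" and a :: "nat \<Rightarrow> 'a \<Rightarrow> real" and b :: "nat \<Rightarrow> real" and \<eta> :: real
  assumes prob: "prob_space \<nu>" and J: "finite J" "J \<noteq> {}"
    and b_pos: "\<And>j. j \<in> J \<Longrightarrow> b j > 0" and b_sum: "(\<Sum>j\<in>J. b j) = 1"
    and int_a: "\<And>j. j \<in> J \<Longrightarrow> integrable \<nu> (a j)" and \<eta>: "\<eta> > 0"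
begin

definition S :: "(nat \<Rightarrow> real) \<Rightarrow> 'a \<Rightarrow> real" where
  "S v x = (\<Sum>j\<in>J. exp (- (v j + a j x) / \<eta>))"

definition softmin :: "(nat \<Rightarrow> real) \<Rightarrow> 'a \<Rightarrow> real" where
  "softmin v x = - \<eta> * ln (S v x)"

text \<open>The entropic Kantorovich dual, with \<open>- v j\<close> as the potential at index
  \<open>j\<close>, so that \<open>v\<close> enters as in \<open>hopf_lax\<close>.\<close>

definition \<Phi> :: "(nat \<Rightarrow> real) \<Rightarrow> real" where
  "\<Phi> v = (\<integral>x. softmin v x \<partial>\<nu>) - (\<Sum>j\<in>J. b j * v j)"

section \<open>Bounds, continuity and maximisation of the regularised dual\<close>

lemma measurable_a: "j \<in> J \<Longrightarrow> a j \<in> borel_measurable \<nu>"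
  using int_a by auto

lemma measurable_S [measurable]: "S v \<in> borel_measurable \<nu>"
  unfolding S_def
proof (rule borel_measurable_sum)
  fix j assume "j \<in> J"
  note [measurable] = measurable_a[OF this]
  show "(\<lambda>x. exp (- (v j + a j x) / \<eta>)) \<in> borel_measurable \<nu>" by measurable
qed

lemma S_pos: "S v x > 0"
  unfolding S_def using J by (intro sum_pos) auto

lemma softmin_le:
  assumes "j \<in> J"
  shows "softmin v x \<le> v j + a j x"
proof -
  have "exp (- (v j + a j x) / \<eta>) \<le> S v x"
    unfolding S_def using J assms by (intro member_le_sum) auto
  then have "- (v j + a j x) / \<eta> \<le> ln (S v x)"
    using S_pos[of v x] by (simp add: ln_ge_iff)
  then show ?thesis using \<eta> by (simp add: softmin_def field_simps)
qed

text \<open>Monotonicity and compatibility with constants in one statement: continuity of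
  \<open>\<Phi>\<close> and the normalisation of \<open>v\<close> by a constant both follow from
  it.\<close>

lemma softmin_mono_shift:
  assumes "\<And>j. j \<in> J \<Longrightarrow> u j \<le> v j + d"
  shows "softmin u x \<le> softmin v x + d"
proof -
  have "exp (- d / \<eta>) * S v x \<le> S u x"
    unfolding S_def sum_distrib_left
  proof (rule sum_mono)
    fix j assume "j \<in> J"
    from assms[OF this] have "- (v j + d + a j x) / \<eta> \<le> - (u j + a j x) / \<eta>"
      using \<eta> by (intro divide_right_mono) auto
    then show "exp (- d / \<eta>) * exp (- (v j + a j x) / \<eta>) \<le> exp (- (u j + a j x) / \<eta>)"
      by (simp add: add_divide_distrib diff_divide_distrib flip: exp_add)
  qed
  then have "ln (exp (- d / \<eta>) * S v x) \<le> ln (S u x)"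
    using S_pos by (subst ln_le_cancel_iff) auto
  then have "- d / \<eta> + ln (S v x) \<le> ln (S u x)"
    using S_pos[of v x] by (simp add: ln_mult)
  then show ?thesis using \<eta> by (simp add: softmin_def field_simps)
qed

lemma integrable_softmin: "integrable \<nu> (softmin v)"
proof -
  interpret prob_space \<nu> by (rule prob)
  have lower: "- (\<Sum>j\<in>J. \<bar>v j + a j x\<bar>) - \<eta> * ln (card J) \<le> softmin v x" for x
  proof -
    define A where "A = (\<Sum>j\<in>J. \<bar>v j + a j x\<bar>)"
    have "S v x \<le> (\<Sum>j\<in>J. exp (A / \<eta>))"
      unfolding S_def
    proof (rule sum_mono)
      fix j assume "j \<in> J"
      then have "\<bar>v j + a j x\<bar> \<le> A" unfolding A_def using J by (intro member_le_sum) auto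
      then show "exp (- (v j + a j x) / \<eta>) \<le> exp (A / \<eta>)"
        using \<eta> unfolding exp_le_cancel_iff by (intro divide_right_mono) auto
    qed
    also have "\<dots> = card J * exp (A / \<eta>)" by simp
    finally have "ln (S v x) \<le> ln (card J * exp (A / \<eta>))"
      using S_pos[of v x] by (subst ln_le_cancel_iff) (auto simp: J card_gt_0_iff)
    also have "\<dots> = ln (card J) + A / \<eta>" using J by (simp add: ln_mult card_gt_0_iff)
    finally show ?thesis using \<eta> by (simp add: softmin_def A_def field_simps)
  qed
  obtain i where i: "i \<in> J" using J by auto
  show ?thesis
  proof (rule Bochner_Integration.integrable_bound)
    show "integrable \<nu> (\<lambda>x. (\<Sum>j\<in>J. \<bar>v j + a j x\<bar>) + \<eta> * ln (card J))"
      using int_a by (intro Bochner_Integration.integrable_add Bochner_Integration.integrable_sum integrable_abs) auto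
    show "softmin v \<in> borel_measurable \<nu>" unfolding softmin_def by measurable
    have "\<bar>softmin v x\<bar> \<le> (\<Sum>j\<in>J. \<bar>v j + a j x\<bar>) + \<eta> * ln (card J)" for x
    proof -
      have "\<bar>v i + a i x\<bar> \<le> (\<Sum>j\<in>J. \<bar>v j + a j x\<bar>)" using J i by (intro member_le_sum) auto
      moreover have "0 \<le> \<eta> * ln (card J)" using J \<eta> by (simp add: Suc_le_eq card_gt_0_iff)
      ultimately show ?thesis using lower[of x] softmin_le[OF i, of v x] by linarith
    qed
    from order_trans[OF this abs_ge_self]
    show "AE x in \<nu>. norm (softmin v x) \<le> norm ((\<Sum>j\<in>J. \<bar>v j + a j x\<bar>) + \<eta> * ln (card J))"
      by simp
  qed
qed

lemma \<Phi>_le: "j \<in> J \<Longrightarrow> \<Phi> v \<le> v j + (\<integral>x. a j x \<partial>\<nu>) - (\<Sum>j\<in>J. b j * v j)"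
proof -
  interpret prob_space \<nu> by (rule prob)
  assume j: "j \<in> J"
  have "(\<integral>x. softmin v x \<partial>\<nu>) \<le> (\<integral>x. v j + a j x \<partial>\<nu>)"
    using softmin_le[OF j] int_a[OF j] integrable_softmin by (intro integral_mono) auto
  then show ?thesis using int_a[OF j] by (simp add: \<Phi>_def prob_space)
qed

lemma \<Phi>_mono_shift:
  assumes "\<And>j. j \<in> J \<Longrightarrow> u j \<le> v j + d"
  shows "\<Phi> u + (\<Sum>j\<in>J. b j * u j) \<le> \<Phi> v + (\<Sum>j\<in>J. b j * v j) + d"
proof -
  interpret prob_space \<nu> by (rule prob)
  have "(\<integral>x. softmin u x \<partial>\<nu>) \<le> (\<integral>x. softmin v x + d \<partial>\<nu>)"
    using softmin_mono_shift[OF assms] integrable_softmin by (intro integral_mono) auto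
  then show ?thesis using integrable_softmin by (simp add: \<Phi>_def prob_space)
qed

text \<open>The topology on \<open>nat \<Rightarrow> real\<close> is the product topology;
  increments of \<open>\<Phi>\<close> are bounded by finite sums of coordinate differences over
  \<open>J\<close>.\<close>

lemma continuous_\<Phi>: "continuous_on UNIV \<Phi>"
  unfolding continuous_on_def
proof safe
  fix v :: "nat \<Rightarrow> real"
  have "continuous_on UNIV (\<lambda>u::nat\<Rightarrow>real. (\<Sum>j\<in>J. \<bar>u j - v j\<bar>) + \<bar>\<Sum>j\<in>J. b j * (u j - v j)\<bar>)"
    by (intro continuous_intros continuous_on_product_coordinates)
  then have lim: "((\<lambda>u::nat\<Rightarrow>real. (\<Sum>j\<in>J. \<bar>u j - v j\<bar>) + \<bar>\<Sum>j\<in>J. b j * (u j - v j)\<bar>) \<longlongrightarrow> 0) (at v)"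
    unfolding continuous_on_def by (auto dest: spec[of _ v])
  have "\<bar>\<Phi> u - \<Phi> v\<bar> \<le> (\<Sum>j\<in>J. \<bar>u j - v j\<bar>) + \<bar>\<Sum>j\<in>J. b j * (u j - v j)\<bar>" for u
  proof -
    define d where "d = (\<Sum>j\<in>J. \<bar>u j - v j\<bar>)"
    have "\<bar>u j - v j\<bar> \<le> d" if "j \<in> J" for j
      unfolding d_def using J that by (intro member_le_sum) auto
    then have "u j \<le> v j + d" "v j \<le> u j + d" if "j \<in> J" for j using that by fastforce+
    then have "\<Phi> u + (\<Sum>j\<in>J. b j * u j) \<le> \<Phi> v + (\<Sum>j\<in>J. b j * v j) + d"
      "\<Phi> v + (\<Sum>j\<in>J. b j * v j) \<le> \<Phi> u + (\<Sum>j\<in>J. b j * u j) + d"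
      by (auto intro!: \<Phi>_mono_shift)
    moreover have "(\<Sum>j\<in>J. b j * (u j - v j)) = (\<Sum>j\<in>J. b j * u j) - (\<Sum>j\<in>J. b j * v j)"
      by (simp add: right_diff_distrib sum_subtractf)
    ultimately show ?thesis by (simp add: d_def)
  qed
  then have "((\<lambda>u. \<Phi> u - \<Phi> v) \<longlongrightarrow> 0) (at v)"
    by (intro Lim_null_comparison[OF _ lim]) auto
  then show "(\<Phi> \<longlongrightarrow> \<Phi> v) (at v within UNIV)" by (simp add: LIM_zero_iff)
qed

text \<open>Subtracting the minimum over \<open>J\<close> and zeroing the coordinates outside
  \<open>J\<close> does not lower \<open>\<Phi>\<close>. A normalised vector has a coordinate 0, so
  by \<open>\<Phi>_le\<close> a large coordinate elsewhere pushes \<open>\<Phi>\<close> below its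
  value at 0. Hence the maximum over a compact box is global.\<close>

lemma \<Phi>_maximizer: "\<exists>v. \<forall>u. \<Phi> u \<le> \<Phi> v"
proof -
  define K where "K = (\<Sum>j\<in>J. \<bar>\<integral>x. a j x \<partial>\<nu>\<bar>)"
  define \<beta> where "\<beta> = Min (b ` J)"
  have \<beta>: "\<beta> > 0" "\<And>j. j \<in> J \<Longrightarrow> \<beta> \<le> b j" using J b_pos by (auto simp: \<beta>_def)
  \<comment> \<open>Chosen so that
    \<open>K - \<beta> * R \<le> \<Phi> (\<lambda>_. 0)\<close>.\<close>
  define R where "R = \<bar>K - \<Phi> (\<lambda>_. 0)\<bar> / \<beta>"
  have R: "R \<ge> 0" "\<beta> * R \<ge> K - \<Phi> (\<lambda>_. 0)" using \<beta> by (auto simp: R_def)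
  \<comment> \<open>Coordinates outside \<open>J\<close> are pinned to 0, so the infinite product is
    compact.\<close>
  define B where "B = (PiE UNIV (\<lambda>j. if j \<in> J then {0..R} else {0}) :: (nat \<Rightarrow> real) set)"
  have zero: "(\<lambda>_. 0) \<in> B" using R by (auto simp: B_def)
  have "compact B" unfolding B_def by (rule compact_PiE_UNIV) auto
  then obtain v where v: "v \<in> B" "\<And>u. u \<in> B \<Longrightarrow> \<Phi> u \<le> \<Phi> v"
    using continuous_attains_sup[of B \<Phi>] zero continuous_on_subset[OF continuous_\<Phi>] by auto
  have "\<Phi> u \<le> \<Phi> v" for u
  proof -
    define c where "c = Min (u ` J)"
    have "c \<in> u ` J" unfolding c_def using J by (intro Min_in) auto
    then obtain i where i: "i \<in> J" "u i = c" by auto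
    have c: "c \<le> u j" if "j \<in> J" for j using J that by (auto simp: c_def)
    define u' where "u' = (\<lambda>j. if j \<in> J then u j - c else 0)"
    have "(\<Sum>j\<in>J. b j * u' j) = (\<Sum>j\<in>J. b j * u j) - c"
      using b_sum by (simp add: u'_def right_diff_distrib sum_subtractf flip: sum_distrib_right)
    moreover have "\<Phi> u + (\<Sum>j\<in>J. b j * u j) \<le> \<Phi> u' + (\<Sum>j\<in>J. b j * u' j) + c"
      by (rule \<Phi>_mono_shift) (simp add: u'_def)
    ultimately have "\<Phi> u \<le> \<Phi> u'" by simp
    also have "\<Phi> u' \<le> \<Phi> v"
    proof (cases "u' \<in> B")
      case True
      then show ?thesis by (rule v)
    next
      case False
      have "\<not> (\<forall>k\<in>J. u' k \<le> R)"
      proof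
        assume "\<forall>k\<in>J. u' k \<le> R"
        then have "u' \<in> B" using c by (auto simp: B_def u'_def)
        with False show False ..
      qed
      then obtain k where k: "k \<in> J" "u' k > R" by (auto simp: not_le)
      have nonneg: "0 \<le> b j * u' j" if "j \<in> J" for j
        using c[OF that] b_pos[OF that] that by (auto simp: u'_def)
      have "\<Phi> u' \<le> u' i + (\<integral>x. a i x \<partial>\<nu>) - (\<Sum>j\<in>J. b j * u' j)" using i(1) by (rule \<Phi>_le)
      also have "(\<integral>x. a i x \<partial>\<nu>) \<le> \<bar>\<integral>x. a i x \<partial>\<nu>\<bar>" by simp
      also have "\<dots> \<le> K" unfolding K_def using i J by (intro member_le_sum) auto
      also have "u' i = 0" using i by (simp add: u'_def)
      finally have "\<Phi> u' \<le> K - (\<Sum>j\<in>J. b j * u' j)" by simp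
      moreover have "\<beta> * R \<le> b k * u' k" using k \<beta>(1) \<beta>(2)[OF k(1)] R by (intro mult_mono) auto
      moreover have "b k * u' k \<le> (\<Sum>j\<in>J. b j * u' j)"
        using nonneg k J by (intro member_le_sum) auto
      ultimately show ?thesis using R(2) v(2)[OF zero] by linarith
    qed
    finally show ?thesis .
  qed
  then show ?thesis by blast
qed

section \<open>The softmin weights, which form the gradient of \<open>softmin\<close> in
  \<open>v\<close>: marginals and cost\<close>

definition plan :: "(nat \<Rightarrow> real) \<Rightarrow> nat \<Rightarrow> 'a \<Rightarrow> real" where
  "plan v j x = exp (- (v j + a j x) / \<eta>) / S v x"

lemma plan_pos: "0 < plan v j x"
  using S_pos[of v x] by (simp add: plan_def)

lemma plan_sum: "(\<Sum>j\<in>J. plan v j x) = 1"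
  unfolding plan_def sum_divide_distrib[symmetric] using S_pos[of v x] by (simp add: S_def)

lemma plan_le_1: "j \<in> J \<Longrightarrow> plan v j x \<le> 1"
  using member_le_sum[of j J "\<lambda>j. plan v j x"] J plan_pos plan_sum[of v x] by (auto simp: less_imp_le)

lemma measurable_plan: "j \<in> J \<Longrightarrow> plan v j \<in> borel_measurable \<nu>"
proof -
  assume "j \<in> J"
  note [measurable] = measurable_a[OF this]
  show ?thesis unfolding plan_def by measurable
qed

lemma integrable_plan: "j \<in> J \<Longrightarrow> integrable \<nu> (plan v j)"
proof -
  interpret prob_space \<nu> by (rule prob)
  assume "j \<in> J"
  then show ?thesis using plan_pos plan_le_1 measurable_plan
    by (intro integrable_const_bound[of _ 1]) (auto simp: less_imp_le abs_of_pos)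
qed

text \<open>The comparison point is a Sinkhorn update of \<open>v\<close>, which raises \<open>\<Phi>\<close> by at least \<open>\<eta>\<close> times
  a relative entropy between the desired and the actual marginals.\<close>
lemma maximizer_marginal:
  assumes max: "\<And>u. \<Phi> u \<le> \<Phi> v" and i: "i \<in> J"
  shows "(\<integral>x. plan v i x \<partial>\<nu>) = b i"
proof -
  interpret prob_space \<nu> by (rule prob)
  define q where "q = (\<lambda>j. \<integral>x. plan v j x \<partial>\<nu>)"
  have q: "q j > 0" if "j \<in> J" for j
  proof -
    have "(\<integral>x. 0 \<partial>\<nu>) < q j" unfolding q_def using integrable_plan[OF that] plan_pos
      by (intro integral_less_AE_space) (auto simp: emeasure_space_1)
    then show ?thesis by simp
  qed
  define r where "r = (\<lambda>j. q j / b j)"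
  have r: "r j > 0" if "j \<in> J" for j using q b_pos that by (simp add: r_def)
  \<comment> \<open>Adding \<open>\<eta> * ln (r j)\<close> divides the exponential weight of index
    \<open>j\<close> by \<open>r j\<close>, the ratio of actual to prescribed mass.\<close>
  define u where "u = (\<lambda>j. v j + \<eta> * ln (r j))"
  define T where "T = (\<lambda>x. \<Sum>j\<in>J. plan v j x / r j)"
  have T: "T x > 0" for x unfolding T_def using J r plan_pos by (intro sum_pos) auto
  have Su: "S u x = S v x * T x" for x
  proof -
    have "exp (- (u j + a j x) / \<eta>) = S v x * (plan v j x / r j)" if "j \<in> J" for j
    proof -
      have "- (u j + a j x) / \<eta> = - (v j + a j x) / \<eta> - ln (r j)"
        using \<eta> by (simp add: u_def field_simps)
      then show ?thesis using r[OF that] S_pos[of v x] by (simp add: exp_diff plan_def)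
    qed
    then show ?thesis unfolding T_def S_def[of u] sum_distrib_left by (intro sum.cong) auto
  qed
  have softmin_u: "softmin u x = softmin v x - \<eta> * ln (T x)" for x
    unfolding softmin_def Su using S_pos[of v x] T[of x] by (simp add: ln_mult algebra_simps)
  have int_T: "integrable \<nu> T" unfolding T_def
    using integrable_plan by (intro Bochner_Integration.integrable_sum) simp
  have "(\<integral>x. T x \<partial>\<nu>) = (\<Sum>j\<in>J. q j / r j)"
    unfolding T_def q_def using integrable_plan by (subst Bochner_Integration.integral_sum) auto
  also have "\<dots> = 1" unfolding b_sum[symmetric] using q b_pos
    by (intro sum.cong) (auto simp: r_def less_imp_neq[symmetric])
  finally have T1: "(\<integral>x. T x \<partial>\<nu>) = 1" .
  \<comment> \<open>Since \<open>T\<close> has mean 1, replacing \<open>ln T\<close> by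
    \<open>T - 1\<close> leaves exactly the integral of \<open>softmin v\<close>.\<close>
  have "(\<integral>x. softmin v x - \<eta> * (T x - 1) \<partial>\<nu>) \<le> (\<integral>x. softmin u x \<partial>\<nu>)"
  proof (rule integral_mono[OF _ integrable_softmin])
    show "integrable \<nu> (\<lambda>x. softmin v x - \<eta> * (T x - 1))" using int_T integrable_softmin by simp
    show "softmin v x - \<eta> * (T x - 1) \<le> softmin u x" for x
      using ln_le_minus_one[OF T[of x]] \<eta> by (simp add: softmin_u)
  qed
  then have "(\<integral>x. softmin v x \<partial>\<nu>) \<le> (\<integral>x. softmin u x \<partial>\<nu>)"
    using int_T integrable_softmin T1 by (simp add: prob_space)
  with max[of u] have "(\<Sum>j\<in>J. b j * v j) \<le> (\<Sum>j\<in>J. b j * u j)" by (simp add: \<Phi>_def)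
  then have "0 \<le> \<eta> * (\<Sum>j\<in>J. b j * ln (r j))"
    by (simp add: u_def distrib_left sum.distrib sum_distrib_left mult.left_commute)
  then have ge: "0 \<le> (\<Sum>j\<in>J. b j * ln (r j))" using \<eta> by (simp add: zero_le_mult_iff)
  have sum_q: "(\<Sum>j\<in>J. q j) = 1"
    unfolding q_def using integrable_plan plan_sum
    by (subst Bochner_Integration.integral_sum[symmetric]) (auto simp: prob_space)
  have "(\<Sum>j\<in>J. b j * (r j - 1)) = (\<Sum>j\<in>J. q j - b j)"
    using b_pos by (intro sum.cong) (auto simp: r_def field_simps less_imp_neq[symmetric])
  also have "\<dots> = 0" using sum_q b_sum by (simp add: sum_subtractf)
  \<comment> \<open>Because both families of masses sum to 1, the relative entropy is a sum of these
    nonnegative terms, each of which vanishes only at \<open>r j = 1\<close>.\<close>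
  finally have "(\<Sum>j\<in>J. b j * (r j - 1 - ln (r j))) \<le> 0"
    using ge by (simp add: right_diff_distrib sum_subtractf)
  moreover have nn: "0 \<le> b j * (r j - 1 - ln (r j))" if "j \<in> J" for j
    using b_pos[OF that] ln_le_minus_one[OF r[OF that]] by simp
  ultimately have "(\<Sum>j\<in>J. b j * (r j - 1 - ln (r j))) = 0"
    by (meson antisym sum_nonneg)
  then have "b i * (r i - 1 - ln (r i)) = 0"
    using nn J i sum_nonneg_eq_0_iff[of J "\<lambda>j. b j * (r j - 1 - ln (r j))"] by blast
  then have "r i = 1" using b_pos[OF i] r[OF i] by (intro ln_eq_minus_one) auto
  then show ?thesis using b_pos[OF i] by (simp add: r_def q_def)
qed

text \<open>Solving the definition of \<open>plan\<close> for the cost gives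
  \<open>a j x = softmin v x - v j - \<eta> * ln (plan v j x)\<close>. The marginals turn the first
  two terms into \<open>\<Phi> v\<close>, and \<open>- p * ln p \<le> 1\<close> bounds the entropy
  term by \<open>\<eta>\<close> per index.\<close>

lemma maximizer_cost:
  assumes "\<And>u. \<Phi> u \<le> \<Phi> v"
  shows "(\<integral>x. (\<Sum>j\<in>J. plan v j x * a j x) \<partial>\<nu>) \<le> \<Phi> v + \<eta> * card J"
proof -
  interpret prob_space \<nu> by (rule prob)
  have le: "(\<Sum>j\<in>J. plan v j x * a j x) \<le> softmin v x - (\<Sum>j\<in>J. v j * plan v j x) + \<eta> * card J" for x
  proof -
    have "plan v j x * a j x \<le> plan v j x * softmin v x - v j * plan v j x + \<eta>" if "j \<in> J" for j
    proof -
      have "ln (plan v j x) = - (v j + a j x) / \<eta> - ln (S v x)"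
        using S_pos[of v x] by (simp add: plan_def ln_div)
      then have eq: "a j x = softmin v x - v j - \<eta> * ln (plan v j x)"
        using \<eta> by (simp add: softmin_def field_simps)
      have "- ln (plan v j x) \<le> 1 / plan v j x - 1"
        using ln_le_minus_one[of "1 / plan v j x"] plan_pos[of v j x] by (simp add: ln_div)
      then have "plan v j x * (- ln (plan v j x)) \<le> plan v j x * (1 / plan v j x - 1)"
        using plan_pos[of v j x] by (intro mult_left_mono) auto
      also have "\<dots> \<le> 1" using plan_pos[of v j x] by (simp add: right_diff_distrib)
      finally have "\<eta> * (plan v j x * (- ln (plan v j x))) \<le> \<eta> * 1" using \<eta> by (intro mult_left_mono) auto
      then show ?thesis by (subst eq) (simp add: algebra_simps)
    qed
    then have "(\<Sum>j\<in>J. plan v j x * a j x) \<le> (\<Sum>j\<in>J. plan v j x * softmin v x - v j * plan v j x + \<eta>)"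
      by (intro sum_mono)
    also have "\<dots> = softmin v x - (\<Sum>j\<in>J. v j * plan v j x) + \<eta> * card J"
      using plan_sum[of v x] by (simp add: sum.distrib sum_subtractf flip: sum_distrib_right)
    finally show ?thesis .
  qed
  have int_sum: "integrable \<nu> (\<lambda>x. \<Sum>j\<in>J. v j * plan v j x)"
    using integrable_plan by (intro Bochner_Integration.integrable_sum) simp
  have int_pa: "integrable \<nu> (\<lambda>x. plan v j x * a j x)" if "j \<in> J" for j
  proof (rule Bochner_Integration.integrable_bound[OF int_a[OF that]])
    show "(\<lambda>x. plan v j x * a j x) \<in> borel_measurable \<nu>"
      using measurable_plan[OF that] measurable_a[OF that] by measurable
    have "\<bar>plan v j x * a j x\<bar> \<le> 1 * \<bar>a j x\<bar>" for x
      unfolding abs_mult using plan_pos[of v j x] plan_le_1[OF that, of v x] by (intro mult_right_mono) auto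
    then show "AE x in \<nu>. norm (plan v j x * a j x) \<le> norm (a j x)" by simp
  qed
  have "(\<integral>x. (\<Sum>j\<in>J. plan v j x * a j x) \<partial>\<nu>)
      \<le> (\<integral>x. softmin v x - (\<Sum>j\<in>J. v j * plan v j x) + \<eta> * card J \<partial>\<nu>)"
    using le int_sum int_pa integrable_softmin by (intro integral_mono) auto
  also have "\<dots> = (\<integral>x. softmin v x \<partial>\<nu>) - (\<integral>x. (\<Sum>j\<in>J. v j * plan v j x) \<partial>\<nu>) + \<eta> * card J"
    using int_sum integrable_softmin by (simp add: prob_space)
  also have "(\<integral>x. (\<Sum>j\<in>J. v j * plan v j x) \<partial>\<nu>) = (\<Sum>j\<in>J. v j * b j)"
    using integrable_plan maximizer_marginal[OF assms] by (subst Bochner_Integration.integral_sum) auto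
  finally show ?thesis by (simp add: \<Phi>_def mult.commute)
qed

end

text \<open>Duality in the form needed: a bound on all dual values yields an almost optimal plan
  with exact marginals. Because \<open>softmin\<close> lies below the minimum, the bound passes to
  \<open>\<Phi>\<close>.\<close>

proposition semidiscrete_plan:
  fixes \<nu> :: "'a measure" and J :: "nat set" and a :: "nat \<Rightarrow> 'a \<Rightarrow> real"
    and b :: "nat \<Rightarrow> real" and \<Lambda> \<epsilon> :: real
  assumes "prob_space \<nu>" "finite J" "J \<noteq> {}"
    and "\<And>j. j \<in> J \<Longrightarrow> b j > 0" "(\<Sum>j\<in>J. b j) = 1"
    and int_a: "\<And>j. j \<in> J \<Longrightarrow> integrable \<nu> (a j)"
    and dual: "\<And>v. (\<integral>x. (MIN j\<in>J. v j + a j x) \<partial>\<nu>) - (\<Sum>j\<in>J. b j * v j) \<le> \<Lambda>"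
    and "\<epsilon> > 0"
  shows "\<exists>p. (\<forall>j\<in>J. p j \<in> borel_measurable \<nu>) \<and> (\<forall>j x. 0 \<le> p j x) \<and>
    (\<forall>x. (\<Sum>j\<in>J. p j x) = 1) \<and> (\<forall>j\<in>J. (\<integral>x. p j x \<partial>\<nu>) = b j) \<and>
    (\<integral>x. (\<Sum>j\<in>J. p j x * a j x) \<partial>\<nu>) \<le> \<Lambda> + \<epsilon>"
proof -
  have card: "card J > 0" using assms by (simp add: card_gt_0_iff)
  \<comment> \<open>The regularisation costs \<open>\<eta>\<close> per index, hence
    \<open>\<epsilon>\<close> in total.\<close>
  define \<eta> where "\<eta> = \<epsilon> / card J"
  interpret entropic_dual \<nu> J a b \<eta>
    by (rule entropic_dual.intro) (use assms card in \<open>auto simp: \<eta>_def\<close>)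
  interpret prob_space \<nu> by fact
  obtain v where v: "\<And>u. \<Phi> u \<le> \<Phi> v" using \<Phi>_maximizer by blast
  have "integrable \<nu> (\<lambda>x. MIN j\<in>J. v j + a j x)"
  proof (rule Bochner_Integration.integrable_bound)
    show "integrable \<nu> (\<lambda>x. \<Sum>j\<in>J. \<bar>v j + a j x\<bar>)"
      using int_a by (intro Bochner_Integration.integrable_sum integrable_abs) auto
    show "(\<lambda>x. MIN j\<in>J. v j + a j x) \<in> borel_measurable \<nu>"
      using measurable_a by (intro borel_measurable_Min assms) auto
    have "\<bar>MIN j\<in>J. v j + a j x\<bar> \<le> (\<Sum>j\<in>J. \<bar>v j + a j x\<bar>)" for x
    proof -
      have "(MIN j\<in>J. v j + a j x) \<in> (\<lambda>j. v j + a j x) ` J" using assms by (intro Min_in) auto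
      then obtain i where i: "i \<in> J" "(MIN j\<in>J. v j + a j x) = v i + a i x" by auto
      show ?thesis unfolding i(2) using i(1) assms by (intro member_le_sum) auto
    qed
    from order_trans[OF this abs_ge_self]
    show "AE x in \<nu>. norm (MIN j\<in>J. v j + a j x) \<le> norm (\<Sum>j\<in>J. \<bar>v j + a j x\<bar>)"
      by simp
  qed
  then have "(\<integral>x. softmin v x \<partial>\<nu>) \<le> (\<integral>x. (MIN j\<in>J. v j + a j x) \<partial>\<nu>)"
    using integrable_softmin softmin_le J by (intro integral_mono) auto
  then have "\<Phi> v \<le> \<Lambda>" using dual[of v] by (simp add: \<Phi>_def)
  moreover have "\<eta> * card J = \<epsilon>" using card by (simp add: \<eta>_def)
  ultimately have "(\<integral>x. (\<Sum>j\<in>J. plan v j x * a j x) \<partial>\<nu>) \<le> \<Lambda> + \<epsilon>"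
    using maximizer_cost[OF v] by simp
  then show ?thesis
    using measurable_plan plan_pos plan_sum maximizer_marginal[OF v]
    by (intro exI[of _ "plan v"]) (auto simp: less_imp_le)
qed

section \<open>Couplings from transport plans\<close>

text \<open>Given \<open>x\<close>, the coupling picks a cell \<open>j\<close> with probability
  \<open>p j x\<close> and then \<open>y\<close> from \<open>\<mu>\<close> conditioned on
  \<open>A j\<close>. Splitting the cost bound as \<open>c j x + e j y\<close> lets each part be
  integrated against one marginal.\<close>

proposition W2sq_le_plan:
  fixes \<mu> \<nu> :: "'a::{metric_space, second_countable_topology} measure"
    and J :: "'i set" and A :: "'i \<Rightarrow> 'a set" and p c e :: "'i \<Rightarrow> 'a \<Rightarrow> real"
  assumes "prob_space \<mu>" "prob_space \<nu>" and sets: "sets \<mu> = sets borel" "sets \<nu> = sets borel"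
    and J: "finite J" and A: "\<And>j. j \<in> J \<Longrightarrow> A j \<in> sets borel" "disjoint_family_on A J"
    and A_cover: "AE y in \<mu>. y \<in> (\<Union>j\<in>J. A j)" and A_pos: "\<And>j. j \<in> J \<Longrightarrow> 0 < measure \<mu> (A j)"
    and p: "\<And>j. j \<in> J \<Longrightarrow> p j \<in> borel_measurable \<nu>" "\<And>j x. 0 \<le> p j x"
      "\<And>x. (\<Sum>j\<in>J. p j x) = 1" "\<And>j. j \<in> J \<Longrightarrow> (\<integral>x. p j x \<partial>\<nu>) = measure \<mu> (A j)"
    and c: "\<And>j. j \<in> J \<Longrightarrow> c j \<in> borel_measurable borel" "\<And>j x. 0 \<le> c j x"
    and e: "\<And>j. j \<in> J \<Longrightarrow> e j \<in> borel_measurable borel" "\<And>j x. 0 \<le> e j x"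
    and dist_le: "\<And>j x y. j \<in> J \<Longrightarrow> y \<in> A j \<Longrightarrow> (dist x y)\<^sup>2 \<le> c j x + e j y"
  shows "W2sq \<nu> \<mu> \<le> (\<Sum>j\<in>J. (\<integral>\<^sup>+x. ennreal (p j x * c j x) \<partial>\<nu>) + (\<integral>\<^sup>+y. ennreal (e j y) * indicator (A j) y \<partial>\<mu>))"
proof -
  interpret \<mu>: prob_space \<mu> by fact
  interpret \<nu>: prob_space \<nu> by fact
  interpret pair_sigma_finite \<nu> \<mu> ..
  note [measurable_cong] = sets
  note [measurable] = p(1) A(1) c(1) e(1)
  define q where "q = (\<lambda>j x. ennreal (p j x / measure \<mu> (A j)))"
  have q_meas[measurable]: "q j \<in> borel_measurable \<nu>" if "j \<in> J" for j
    unfolding q_def using that by measurable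
  have q_int: "(\<integral>\<^sup>+x. q j x \<partial>\<nu>) = 1" if j: "j \<in> J" for j
  proof -
    have "integrable \<nu> (p j)"
    proof (rule \<nu>.integrable_const_bound[of _ 1])
      have "p j x \<le> 1" for x
        using member_le_sum[of j J "\<lambda>j. p j x"] j J p(2) p(3)[of x] by auto
      then show "AE x in \<nu>. norm (p j x) \<le> 1" using p(2) by simp
    qed (rule p(1)[OF j])
    then have "(\<integral>\<^sup>+x. q j x \<partial>\<nu>) = ennreal (\<integral>x. p j x / measure \<mu> (A j) \<partial>\<nu>)"
      unfolding q_def using p(2) by (intro nn_integral_eq_integral) auto
    also have "\<dots> = 1" using p(4)[OF j] A_pos[OF j] by simp
    finally show ?thesis .
  qed
  have q_A: "q j x * emeasure \<mu> (A j) = ennreal (p j x)" if "j \<in> J" for j x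
    using A_pos[OF that] p(2) by (simp add: q_def \<mu>.emeasure_eq_measure flip: ennreal_mult)
  define \<rho> where "\<rho> = (\<lambda>(x, y). \<Sum>j\<in>J. q j x * indicator (A j) y)"
  have [measurable]: "\<rho> \<in> borel_measurable (\<nu> \<Otimes>\<^sub>M \<mu>)"
    unfolding \<rho>_def by measurable
  define \<pi> where "\<pi> = density (\<nu> \<Otimes>\<^sub>M \<mu>) \<rho>"
  \<comment> \<open>Second countability identifies the product of the Borel sigma-algebras with the
    Borel sigma-algebra of the product.\<close>
  have sets_prod: "sets (\<nu> \<Otimes>\<^sub>M \<mu>) = sets (borel :: ('a \<times> 'a) measure)"
    using sets_pair_measure_cong[OF sets(2,1)] unfolding borel_prod .
  have sets_\<pi>: "sets \<pi> = sets borel" by (simp add: \<pi>_def sets_prod)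
  note [measurable_cong] = sets_\<pi>
  have int_\<pi>: "(\<integral>\<^sup>+z. h z \<partial>\<pi>) = (\<integral>\<^sup>+x. \<integral>\<^sup>+y. (\<Sum>j\<in>J. q j x * indicator (A j) y) * h (x, y) \<partial>\<mu> \<partial>\<nu>)"
    if "h \<in> borel_measurable borel" for h :: "'a \<times> 'a \<Rightarrow> ennreal"
  proof -
    have [measurable]: "h \<in> borel_measurable (\<nu> \<Otimes>\<^sub>M \<mu>)"
      using that by (simp add: measurable_cong_sets[OF sets_prod refl])
    have "(\<integral>\<^sup>+z. h z \<partial>\<pi>) = (\<integral>\<^sup>+z. \<rho> z * h z \<partial>(\<nu> \<Otimes>\<^sub>M \<mu>))"
      unfolding \<pi>_def by (rule nn_integral_density) measurable
    also have "\<dots> = (\<integral>\<^sup>+x. \<integral>\<^sup>+y. \<rho> (x, y) * h (x, y) \<partial>\<mu> \<partial>\<nu>)"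
      by (rule \<mu>.nn_integral_fst[symmetric]) measurable
    finally show ?thesis by (simp add: \<rho>_def)
  qed
  have em_\<pi>: "emeasure \<pi> X = (\<integral>\<^sup>+x. \<integral>\<^sup>+y. (\<Sum>j\<in>J. q j x * indicator (A j) y) * indicator X (x, y) \<partial>\<mu> \<partial>\<nu>)"
    if "X \<in> sets borel" for X
    using int_\<pi>[of "indicator X"] that by (simp add: sets_\<pi>)
  have "distr \<pi> borel fst = \<nu>"
  proof (rule measure_eqI)
    fix B assume "B \<in> sets (distr \<pi> borel fst)"
    then have B[measurable]: "B \<in> sets borel" by simp
    have "emeasure (distr \<pi> borel fst) B = emeasure \<pi> (fst -` B)"
      by (subst emeasure_distr) (auto simp: \<pi>_def space_pair_measure sets_eq_imp_space_eq[OF sets(1)] sets_eq_imp_space_eq[OF sets(2)])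
    also have "\<dots> = (\<integral>\<^sup>+x. \<integral>\<^sup>+y. (\<Sum>j\<in>J. q j x * indicator (A j) y) * indicator (fst -` B) (x, y) \<partial>\<mu> \<partial>\<nu>)"
      by (rule em_\<pi>) (use measurable_sets_borel[OF borel_measurable_continuous_onI[OF continuous_on_fst[OF continuous_on_id]], of B] B in simp)
    also have "\<dots> = (\<integral>\<^sup>+x. (\<Sum>j\<in>J. q j x * emeasure \<mu> (A j)) * indicator B x \<partial>\<nu>)"
    proof (rule nn_integral_cong)
      fix x
      have "(\<integral>\<^sup>+y. (\<Sum>j\<in>J. q j x * indicator (A j) y) * indicator (fst -` B) (x, y) \<partial>\<mu>)
        = (\<integral>\<^sup>+y. (\<Sum>j\<in>J. q j x * indicator (A j) y) * indicator B x \<partial>\<mu>)"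
        by (intro nn_integral_cong) (auto split: split_indicator)
      also have "\<dots> = (\<Sum>j\<in>J. \<integral>\<^sup>+y. q j x * indicator (A j) y \<partial>\<mu>) * indicator B x"
        by (subst nn_integral_multc, measurable) (subst nn_integral_sum, auto)
      also have "(\<Sum>j\<in>J. \<integral>\<^sup>+y. q j x * indicator (A j) y \<partial>\<mu>) = (\<Sum>j\<in>J. q j x * emeasure \<mu> (A j))"
        using A(1) by (intro sum.cong refl nn_integral_cmult_indicator) (auto simp: sets)
      finally show "(\<integral>\<^sup>+y. (\<Sum>j\<in>J. q j x * indicator (A j) y) * indicator (fst -` B) (x, y) \<partial>\<mu>) = (\<Sum>j\<in>J. q j x * emeasure \<mu> (A j)) * indicator B x" .
    qed
    \<comment> \<open>The masses of the cells cancel the normalisation in \<open>q\<close>, and the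
      weights \<open>p j x\<close> sum to 1.\<close>
    also have "\<dots> = (\<integral>\<^sup>+x. indicator B x \<partial>\<nu>)"
      using p(2,3) by (simp add: q_A)
    also have "\<dots> = emeasure \<nu> B" by simp
    finally show "emeasure (distr \<pi> borel fst) B = emeasure \<nu> B" .
  qed (simp add: sets)
  moreover have "distr \<pi> borel snd = \<mu>"
  proof (rule measure_eqI)
    fix B assume "B \<in> sets (distr \<pi> borel snd)"
    then have B[measurable]: "B \<in> sets borel" by simp
    have "emeasure (distr \<pi> borel snd) B = emeasure \<pi> (snd -` B)"
      by (subst emeasure_distr) (auto simp: \<pi>_def space_pair_measure sets_eq_imp_space_eq[OF sets(1)] sets_eq_imp_space_eq[OF sets(2)])
    also have "\<dots> = (\<integral>\<^sup>+x. \<integral>\<^sup>+y. (\<Sum>j\<in>J. q j x * indicator (A j) y) * indicator (snd -` B) (x, y) \<partial>\<mu> \<partial>\<nu>)"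
      by (rule em_\<pi>) (use measurable_sets_borel[OF borel_measurable_continuous_onI[OF continuous_on_snd[OF continuous_on_id]], of B] B in simp)
    also have "\<dots> = (\<integral>\<^sup>+x. (\<Sum>j\<in>J. q j x * emeasure \<mu> (A j \<inter> B)) \<partial>\<nu>)"
    proof (rule nn_integral_cong)
      fix x
      have "(\<integral>\<^sup>+y. (\<Sum>j\<in>J. q j x * indicator (A j) y) * indicator (snd -` B) (x, y) \<partial>\<mu>)
        = (\<integral>\<^sup>+y. (\<Sum>j\<in>J. q j x * indicator (A j \<inter> B) y) \<partial>\<mu>)"
        unfolding sum_distrib_right by (intro nn_integral_cong sum.cong) (auto split: split_indicator)
      also have "\<dots> = (\<Sum>j\<in>J. \<integral>\<^sup>+y. q j x * indicator (A j \<inter> B) y \<partial>\<mu>)"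
        by (rule nn_integral_sum) measurable
      also have "\<dots> = (\<Sum>j\<in>J. q j x * emeasure \<mu> (A j \<inter> B))"
        using A(1) B by (intro sum.cong refl nn_integral_cmult_indicator) (auto simp: sets)
      finally show "(\<integral>\<^sup>+y. (\<Sum>j\<in>J. q j x * indicator (A j) y) * indicator (snd -` B) (x, y) \<partial>\<mu>) = (\<Sum>j\<in>J. q j x * emeasure \<mu> (A j \<inter> B))" .
    qed
    \<comment> \<open>The marginal condition on \<open>p\<close> enters here: each
      \<open>q j\<close> has total \<open>\<nu>\<close>-mass 1.\<close>
    also have "\<dots> = (\<Sum>j\<in>J. emeasure \<mu> (A j \<inter> B))"
      by (subst nn_integral_sum) (auto simp: nn_integral_multc q_int)
    also have "\<dots> = emeasure \<mu> (\<Union>j\<in>J. A j \<inter> B)"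
      using A B J by (intro sum_emeasure) (auto simp: sets disjoint_family_on_def)
    also have "\<dots> = emeasure \<mu> B"
      using A_cover A(1) B J by (intro emeasure_eq_AE) (auto simp: sets)
    finally show "emeasure (distr \<pi> borel snd) B = emeasure \<mu> B" .
  qed (simp add: sets)
  moreover have "prob_space \<pi>"
    using \<open>distr \<pi> borel fst = \<nu>\<close> \<open>prob_space \<nu>\<close> by (intro prob_space_distrD[of fst \<pi> borel]) (simp_all add: \<pi>_def)
  ultimately have "\<pi> \<in> couplings \<nu> \<mu>" by (simp add: couplings_def sets_\<pi>)
  then have "W2sq \<nu> \<mu> \<le> (\<integral>\<^sup>+ z. ennreal ((dist (fst z) (snd z))\<^sup>2) \<partial>\<pi>)"
    unfolding W2sq_def by (rule INF_lower)
  also have "\<dots> = (\<integral>\<^sup>+x. \<integral>\<^sup>+y. (\<Sum>j\<in>J. q j x * indicator (A j) y) * ennreal ((dist x y)\<^sup>2) \<partial>\<mu> \<partial>\<nu>)"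
    by (subst int_\<pi>) (auto intro!: borel_measurable_continuous_onI continuous_intros)
  also have "\<dots> \<le> (\<integral>\<^sup>+x. \<integral>\<^sup>+y. (\<Sum>j\<in>J. q j x * ennreal (c j x) * indicator (A j) y + q j x * (ennreal (e j y) * indicator (A j) y)) \<partial>\<mu> \<partial>\<nu>)"
    unfolding sum_distrib_right
  proof (intro nn_integral_mono sum_mono)
    fix x y j assume "j \<in> J"
    show "q j x * indicator (A j) y * ennreal ((dist x y)\<^sup>2)
      \<le> q j x * ennreal (c j x) * indicator (A j) y + q j x * (ennreal (e j y) * indicator (A j) y)"
    proof (cases "y \<in> A j")
      case True
      have "ennreal ((dist x y)\<^sup>2) \<le> ennreal (c j x) + ennreal (e j y)"
        using dist_le[OF \<open>j \<in> J\<close> True, of x] c(2) e(2) by (simp flip: ennreal_plus)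
      then have "q j x * ennreal ((dist x y)\<^sup>2) \<le> q j x * (ennreal (c j x) + ennreal (e j y))"
        by (rule mult_left_mono) simp
      then show ?thesis using True by (simp add: distrib_left)
    qed simp
  qed
  also have "\<dots> = (\<integral>\<^sup>+x. (\<Sum>j\<in>J. ennreal (p j x * c j x) + q j x * (\<integral>\<^sup>+y. ennreal (e j y) * indicator (A j) y \<partial>\<mu>)) \<partial>\<nu>)"
  proof (rule nn_integral_cong)
    fix x
    have "(\<integral>\<^sup>+y. q j x * ennreal (c j x) * indicator (A j) y + q j x * (ennreal (e j y) * indicator (A j) y) \<partial>\<mu>)
      = ennreal (p j x * c j x) + q j x * (\<integral>\<^sup>+y. ennreal (e j y) * indicator (A j) y \<partial>\<mu>)" if j: "j \<in> J" for j
    proof -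
      have "(\<integral>\<^sup>+y. q j x * ennreal (c j x) * indicator (A j) y \<partial>\<mu>) = q j x * ennreal (c j x) * emeasure \<mu> (A j)"
        using A(1)[OF j] by (intro nn_integral_cmult_indicator) (simp add: sets)
      also have "\<dots> = q j x * emeasure \<mu> (A j) * ennreal (c j x)" by (simp add: ac_simps)
      also have "\<dots> = ennreal (p j x * c j x)" using q_A[OF j] p(2) c(2) by (simp add: ennreal_mult)
      finally show ?thesis using j by (subst nn_integral_add) (auto simp: nn_integral_cmult)
    qed
    then show "(\<integral>\<^sup>+y. (\<Sum>j\<in>J. q j x * ennreal (c j x) * indicator (A j) y + q j x * (ennreal (e j y) * indicator (A j) y)) \<partial>\<mu>) =
      (\<Sum>j\<in>J. ennreal (p j x * c j x) + q j x * (\<integral>\<^sup>+y. ennreal (e j y) * indicator (A j) y \<partial>\<mu>))"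
      by (subst nn_integral_sum) auto
  qed
  also have "\<dots> = (\<Sum>j\<in>J. (\<integral>\<^sup>+x. ennreal (p j x * c j x) \<partial>\<nu>) + (\<integral>\<^sup>+y. ennreal (e j y) * indicator (A j) y \<partial>\<mu>))"
  proof (subst nn_integral_sum)
    show "(\<lambda>x. ennreal (p j x * c j x) + q j x * (\<integral>\<^sup>+y. ennreal (e j y) * indicator (A j) y \<partial>\<mu>)) \<in> borel_measurable \<nu>"
      if "j \<in> J" for j using that by measurable
    show "(\<Sum>j\<in>J. \<integral>\<^sup>+x. ennreal (p j x * c j x) + q j x * (\<integral>\<^sup>+y. ennreal (e j y) * indicator (A j) y \<partial>\<mu>) \<partial>\<nu>)
      = (\<Sum>j\<in>J. (\<integral>\<^sup>+x. ennreal (p j x * c j x) \<partial>\<nu>) + (\<integral>\<^sup>+y. ennreal (e j y) * indicator (A j) y \<partial>\<mu>))"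
    proof (rule sum.cong[OF refl])
      fix j assume j: "j \<in> J"
      then show "(\<integral>\<^sup>+x. ennreal (p j x * c j x) + q j x * (\<integral>\<^sup>+y. ennreal (e j y) * indicator (A j) y \<partial>\<mu>) \<partial>\<nu>)
        = (\<integral>\<^sup>+x. ennreal (p j x * c j x) \<partial>\<nu>) + (\<integral>\<^sup>+y. ennreal (e j y) * indicator (A j) y \<partial>\<mu>)"
        by (subst nn_integral_add) (auto simp: nn_integral_multc q_int)
    qed
  qed
  finally show ?thesis .
qed

section \<open>The transport inequality\<close>

text \<open>Needed because the costs of the discretised problem must be
  \<open>\<nu>\<close>-integrable. The dual inequality is tested with a discretised, capped square
  of the distance to \<open>x0\<close>; the resulting bound does not depend on the cap
  \<open>N\<close>, and Fatou's lemma removes it.\<close>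

lemma entropy_second_moment:
  fixes \<mu> \<nu> :: "'a::metric_space measure"
  assumes "prob_space \<mu>" and sets_\<mu>: "sets \<mu> = sets borel" and C: "C > 0" and lsi: "LSI_plus \<mu> C"
    and int_\<mu>: "integrable \<mu> (\<lambda>x. (dist x0 x)\<^sup>2)"
    and "prob_space \<nu>" and sets_\<nu>: "sets \<nu> = sets borel" and ac: "absolutely_continuous \<mu> \<nu>"
    and int_ln: "integrable \<nu> (\<lambda>x. ln (enn2real (RN_deriv \<mu> \<nu> x)))"
  shows "integrable \<nu> (\<lambda>x. (dist x0 x)\<^sup>2)"
proof -
  interpret \<mu>: prob_space \<mu> by fact
  interpret \<nu>: prob_space \<nu> by fact
  note [measurable_cong] = sets_\<mu> sets_\<nu>
  have [measurable]: "dist x0 \<in> borel_measurable borel"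
    by (intro borel_measurable_continuous_onI continuous_intros)
  define H where "H = (\<integral>x. ln (enn2real (RN_deriv \<mu> \<nu> x)) \<partial>\<nu>)"
  define K where "K = 3 * (C * H + (\<integral>x. (dist x0 x)\<^sup>2 \<partial>\<mu>) + 1)"
  have trunc: "(\<integral>\<^sup>+x. ennreal ((min (dist x0 x) (real N))\<^sup>2) \<partial>\<nu>) \<le> ennreal K" for N :: nat
  proof -
    \<comment> \<open>Index \<open>i < N\<close> stands for the shell of radii in
      \<open>[i, i + 1)\<close> and carries the distance excess beyond radius \<open>i + 1\<close>;
      index \<open>N\<close> collects everything farther out, at zero distance cost.\<close>
    define D where "D = (\<lambda>i x. if i = N then 0 else max 0 (dist x0 x - real (i + 1)))"
    define v :: "nat \<Rightarrow> real" where "v = (\<lambda>i. (real i)\<^sup>2)"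
    define s where "s = (\<lambda>x. min N (nat \<lfloor>dist x0 x\<rfloor>))"
    have s: "s x \<in> {..N}" "D (s x) x = 0" for x
      unfolding s_def D_def by (auto simp: min_def) linarith+
    interpret hopf_lax_lsi \<mu> C "{..N}" D
    proof
      show "D j y \<le> D j x + dist x y" for j x y
        using dist_triangle[of x0 y x] by (auto simp: D_def)
      show "AE x in \<mu>. \<exists>j\<in>{..N}. D j x = 0" using s by blast
    qed (use assms in \<open>auto simp: D_def \<mu>.emeasure_space_1\<close>)
    have [measurable]: "s \<in> measurable borel (count_space UNIV)" unfolding s_def by measurable
    have "(\<integral>x. hopf_lax {..N} D v x \<partial>\<nu>) \<le> C * H + (\<integral>x. v (s x) \<partial>\<mu>)"
      unfolding H_def using s assms by (intro integral_hopf_lax_le) (auto intro!: exI AE_I2)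
    also have "(\<integral>x. v (s x) \<partial>\<mu>) \<le> (\<integral>x. (dist x0 x)\<^sup>2 \<partial>\<mu>)"
    proof (rule integral_mono[OF _ int_\<mu>])
      have "v (s x) \<le> (real N)\<^sup>2" "0 \<le> v (s x)" for x using s(1)[of x] by (auto simp: v_def)
      then show "integrable \<mu> (\<lambda>x. v (s x))"
        by (intro \<mu>.integrable_const_bound[of _ "(real N)\<^sup>2"]) auto
      show "v (s x) \<le> (dist x0 x)\<^sup>2" for x
      proof -
        have "s x \<le> nat \<lfloor>dist x0 x\<rfloor>" by (simp add: s_def)
        then have "real (s x) \<le> real (nat \<lfloor>dist x0 x\<rfloor>)" by (rule of_nat_mono)
        also have "\<dots> \<le> dist x0 x" by (rule of_nat_floor) simp
        finally show ?thesis unfolding v_def by (rule power_mono) simp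
      qed
    qed
    finally have le: "(\<integral>x. hopf_lax {..N} D v x \<partial>\<nu>) \<le> C * H + (\<integral>x. (dist x0 x)\<^sup>2 \<partial>\<mu>)" by simp
    have int: "integrable \<nu> (hopf_lax {..N} D v)"
      using assms by (intro integrable_hopf_lax) auto
    \<comment> \<open>Radius \<open>j\<close>, shell width 1 and excess \<open>D j x\<close> add up
      to at least the truncated distance; squaring three summands costs the factor 3 in
      \<open>K\<close>.\<close>
    have pt: "(min (dist x0 x) (real N))\<^sup>2 \<le> 3 * (hopf_lax {..N} D v x + 1)" for x
    proof -
      define j where "j = sel v x"
      have j: "hopf_lax {..N} D v x = (real j)\<^sup>2 + (D j x)\<^sup>2"
        using sel(2)[of v x] by (simp add: j_def v_def)
      have "min (dist x0 x) (real N) \<le> real j + 1 + D j x" by (auto simp: D_def)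
      then have "(min (dist x0 x) (real N))\<^sup>2 \<le> (real j + 1 + D j x)\<^sup>2"
        by (intro power_mono) auto
      also have "\<dots> \<le> 3 * ((real j)\<^sup>2 + 1 + (D j x)\<^sup>2)"
        using zero_le_power2[of "real j - 1"] zero_le_power2[of "real j - D j x"] zero_le_power2[of "D j x - 1"]
        by (simp add: power2_eq_square algebra_simps)
      finally show ?thesis by (simp add: j)
    qed
    have "(\<integral>\<^sup>+x. ennreal ((min (dist x0 x) (real N))\<^sup>2) \<partial>\<nu>) \<le> (\<integral>\<^sup>+x. ennreal (3 * (hopf_lax {..N} D v x + 1)) \<partial>\<nu>)"
      using pt by (intro nn_integral_mono ennreal_leI)
    also have "\<dots> = ennreal (\<integral>x. 3 * (hopf_lax {..N} D v x + 1) \<partial>\<nu>)"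
      using int order_trans[OF zero_le_power2 pt] by (intro nn_integral_eq_integral) auto
    also have "\<dots> \<le> ennreal K"
      using int le by (intro ennreal_leI) (simp add: K_def \<nu>.prob_space)
    finally show ?thesis .
  qed
  \<comment> \<open>The truncations are eventually constant at each point, which puts the integrand
    in the form for Fatou's lemma.\<close>
  have "(\<integral>\<^sup>+x. ennreal ((dist x0 x)\<^sup>2) \<partial>\<nu>) = (\<integral>\<^sup>+x. liminf (\<lambda>N. ennreal ((min (dist x0 x) (real N))\<^sup>2)) \<partial>\<nu>)"
  proof (rule nn_integral_cong)
    fix x
    obtain N0 :: nat where "dist x0 x \<le> real N0" using real_arch_simple by blast
    then have "eventually (\<lambda>N. dist x0 x \<le> real N) sequentially"
      by (intro eventually_sequentiallyI[of N0]) auto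
    then have "eventually (\<lambda>N. ennreal ((min (dist x0 x) (real N))\<^sup>2) = ennreal ((dist x0 x)\<^sup>2)) sequentially"
      by eventually_elim (simp add: min_absorb1)
    then have "(\<lambda>N. ennreal ((min (dist x0 x) (real N))\<^sup>2)) \<longlonglongrightarrow> ennreal ((dist x0 x)\<^sup>2)"
      by (rule tendsto_eventually)
    then show "ennreal ((dist x0 x)\<^sup>2) = liminf (\<lambda>N. ennreal ((min (dist x0 x) (real N))\<^sup>2))"
      by (intro lim_imp_Liminf[symmetric]) auto
  qed
  also have "\<dots> \<le> liminf (\<lambda>N. \<integral>\<^sup>+x. ennreal ((min (dist x0 x) (real N))\<^sup>2) \<partial>\<nu>)"
    by (rule nn_integral_liminf) measurable
  also have "\<dots> \<le> limsup (\<lambda>N. \<integral>\<^sup>+x. ennreal ((min (dist x0 x) (real N))\<^sup>2) \<partial>\<nu>)"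
    by (rule Liminf_le_Limsup) simp
  also have "\<dots> \<le> ennreal K" using trunc by (intro Limsup_bounded) auto
  finally have "(\<integral>\<^sup>+x. ennreal ((dist x0 x)\<^sup>2) \<partial>\<nu>) < \<infinity>"
    by (rule le_less_trans) simp
  then show ?thesis by (intro integrableI_bounded) auto
qed

section \<open>Approximation by finitely many cells\<close>

lemma integral_tail_tendsto_0:
  fixes f :: "'a \<Rightarrow> real" and T :: "nat \<Rightarrow> 'a set"
  assumes f: "integrable M f" and T: "\<And>n. T n \<in> sets M"
    and ev: "\<And>x. eventually (\<lambda>n. x \<notin> T n) sequentially"
  shows "(\<lambda>n. \<integral>x. f x * indicator (T n) x \<partial>M) \<longlonglongrightarrow> 0"
proof -
  note [measurable] = T
  have "(\<lambda>n. \<integral>x. f x * indicator (T n) x \<partial>M) \<longlonglongrightarrow> (\<integral>x. 0 \<partial>M)"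
  proof (rule integral_dominated_convergence[where w = "\<lambda>x. \<bar>f x\<bar>"])
    show "AE x in M. (\<lambda>n. f x * indicator (T n) x) \<longlonglongrightarrow> 0"
    proof (rule AE_I2)
      fix x
      from ev[of x] have "eventually (\<lambda>n. f x * indicator (T n) x = 0) sequentially"
        by eventually_elim simp
      then show "(\<lambda>n. f x * indicator (T n) x) \<longlonglongrightarrow> 0" by (rule tendsto_eventually)
    qed
  qed (use f in \<open>auto split: split_indicator\<close>)
  then show ?thesis by simp
qed

text \<open>The space is cut into \<open>n\<close> cells of diameter at most \<open>\<delta>\<close>
  and one remainder cell, which is free in the dual problem. The true cost of the remainder is paid
  separately: its \<open>\<mu>\<close>-mass is small even after multiplication by
  \<open>M\<^sup>2\<close>, and \<open>\<nu>\<close> has little second moment beyond radius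
  \<open>M\<close>.\<close>

lemma W2sq_le_entropy_approx:
  fixes \<mu> \<nu> :: "'a::{metric_space, second_countable_topology} measure"
  assumes "prob_space \<mu>" and sets_\<mu>: "sets \<mu> = sets borel" and C: "C > 0" and lsi: "LSI_plus \<mu> C"
    and int_\<mu>: "integrable \<mu> (\<lambda>x. (dist x0 x)\<^sup>2)"
    and "prob_space \<nu>" and sets_\<nu>: "sets \<nu> = sets borel" and ac: "absolutely_continuous \<mu> \<nu>"
    and int_ln: "integrable \<nu> (\<lambda>x. ln (enn2real (RN_deriv \<mu> \<nu> x)))"
    and \<Lambda>: "\<Lambda> = C * (\<integral>x. ln (enn2real (RN_deriv \<mu> \<nu> x)) \<partial>\<nu>)" and \<delta>: "\<delta> > 0"
  shows "W2sq \<nu> \<mu> \<le> ennreal ((1 + \<delta>) * (\<Lambda> + \<delta>) + (\<delta> + \<delta>\<^sup>2) + 4 * \<delta>)"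
proof -
  interpret \<mu>: prob_space \<mu> by fact
  interpret \<nu>: prob_space \<nu> by fact
  note [measurable_cong] = sets_\<mu> sets_\<nu>
  define d where "d = (\<lambda>x. dist x0 x)"
  have [measurable]: "d \<in> borel_measurable borel" unfolding d_def by measurable
  have d2\<mu>: "integrable \<mu> (\<lambda>x. (d x)\<^sup>2)" using int_\<mu> by (simp add: d_def)
  have d2\<nu>: "integrable \<nu> (\<lambda>x. (d x)\<^sup>2)"
    unfolding d_def using entropy_second_moment[of \<mu> C x0 \<nu>] assms by blast
  \<comment> \<open>The radius is fixed first, from the second moment of \<open>\<nu>\<close>; the
    number of cells may then depend on it.\<close>
  have "(\<lambda>k. \<integral>x. (d x)\<^sup>2 * indicator {x. real k \<le> d x} x \<partial>\<nu>) \<longlonglongrightarrow> 0"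
  proof (rule integral_tail_tendsto_0[OF d2\<nu>])
    fix x
    obtain k0 :: nat where "d x < real k0" using reals_Archimedean2 by blast
    then show "eventually (\<lambda>k. x \<notin> {x. real k \<le> d x}) sequentially"
      by (intro eventually_sequentiallyI[of k0]) auto
  qed measurable
  then have "eventually (\<lambda>k. (\<integral>x. (d x)\<^sup>2 * indicator {x. real k \<le> d x} x \<partial>\<nu>) < \<delta>) sequentially"
    using \<delta> by (rule order_tendstoD)
  then obtain k where k: "(\<integral>x. (d x)\<^sup>2 * indicator {x. real k \<le> d x} x \<partial>\<nu>) < \<delta>"
    by (auto simp: eventually_sequentially)
  define M where "M = real k"
  define tail where "tail = (\<lambda>x. (d x)\<^sup>2 * indicator {x. M \<le> d x} x)"
  have "{x. M \<le> d x} \<in> sets \<nu>" by measurable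
  then have int_tail: "integrable \<nu> tail"
    unfolding tail_def using integrable_mult_indicator[OF _ d2\<nu>, of "{x. M \<le> d x}"]
    by (simp add: mult.commute)
  have tail: "(\<integral>x. tail x \<partial>\<nu>) < \<delta>" using k by (simp add: tail_def M_def)

  obtain Q :: "'a set" where Q: "countable Q" "\<And>X. open X \<Longrightarrow> X \<noteq> {} \<Longrightarrow> \<exists>q\<in>Q. q \<in> X"
    using countable_dense_setE by blast
  have "Q \<noteq> {}" using Q(2)[of UNIV] by auto
  define z where "z = from_nat_into Q"
  have dense: "\<exists>i. dist (z i) y < \<delta> / 2" for y
  proof -
    obtain q where "q \<in> Q" "q \<in> ball y (\<delta> / 2)" using Q(2)[of "ball y (\<delta> / 2)"] \<delta> by auto
    moreover obtain i where "z i = q"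
      unfolding z_def using from_nat_into_surj[OF Q(1) \<open>q \<in> Q\<close>] by blast
    ultimately show ?thesis by (auto simp: dist_commute)
  qed
  \<comment> \<open>The first centre within \<open>\<delta> / 2\<close> makes the covering balls
    disjoint.\<close>
  define idx where "idx = (\<lambda>y. LEAST i. dist (z i) y < \<delta> / 2)"
  have idx: "dist (z (idx y)) y < \<delta> / 2" for y
    unfolding idx_def by (rule LeastI_ex[OF dense])
  have [measurable]: "idx \<in> measurable borel (count_space UNIV)"
    unfolding idx_def by measurable
  have "(\<lambda>n. \<integral>y. ((d y)\<^sup>2 + M\<^sup>2) * indicator {y. n \<le> idx y} y \<partial>\<mu>) \<longlonglongrightarrow> 0"
  proof (rule integral_tail_tendsto_0)
    show "eventually (\<lambda>n. y \<notin> {y. n \<le> idx y}) sequentially" for y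
      by (intro eventually_sequentiallyI[of "Suc (idx y)"]) auto
  qed (use d2\<mu> in \<open>auto\<close>)
  then have "eventually (\<lambda>n. (\<integral>y. ((d y)\<^sup>2 + M\<^sup>2) * indicator {y. n \<le> idx y} y \<partial>\<mu>) < \<delta>) sequentially"
    using \<delta> by (rule order_tendstoD)
  then obtain n where n: "(\<integral>y. ((d y)\<^sup>2 + M\<^sup>2) * indicator {y. n \<le> idx y} y \<partial>\<mu>) < \<delta>"
    by (auto simp: eventually_sequentially)

  define cell where "cell = (\<lambda>y. min n (idx y))"
  have [measurable]: "cell \<in> measurable borel (count_space UNIV)"
    unfolding cell_def by measurable
  define A where "A = (\<lambda>j. {y. cell y = j})"
  have A_sets[measurable]: "A j \<in> sets borel" for j unfolding A_def by measurable
  define b where "b = (\<lambda>j. measure \<mu> (A j))"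
  \<comment> \<open>Null cells are dropped, since the dual problem requires positive masses.\<close>
  define J where "J = {j\<in>{..n}. 0 < b j}"
  have fin_J: "finite J" by (simp add: J_def)
  have "AE y in \<mu>. \<forall>j\<in>{..n} - J. y \<notin> A j"
  proof (rule AE_finite_allI)
    fix j assume "j \<in> {..n} - J"
    then have "\<mu>.prob (A j) = 0" using measure_nonneg[of \<mu> "A j"] by (auto simp: J_def b_def)
    then show "AE y in \<mu>. y \<notin> A j" using \<mu>.prob_eq_0[of "A j"] by (simp add: sets_\<mu>)
  qed simp
  then have cell_J: "AE y in \<mu>. cell y \<in> J"
    by eventually_elim (auto simp: A_def cell_def)
  have int_cell: "(\<integral>y. v (cell y) \<partial>\<mu>) = (\<Sum>j\<in>J. b j * v j)" for v :: "nat \<Rightarrow> real"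
  proof -
    have "(\<integral>y. v (cell y) \<partial>\<mu>) = (\<integral>y. (\<Sum>j\<in>J. v j * indicator (A j) y) \<partial>\<mu>)"
    proof (rule integral_cong_AE)
      show "AE y in \<mu>. v (cell y) = (\<Sum>j\<in>J. v j * indicator (A j) y)"
        using cell_J
      proof eventually_elim
        case (elim y)
        have "(\<Sum>j\<in>J. v j * indicator (A j) y) = (\<Sum>j\<in>J. if cell y = j then v j else 0)"
          by (intro sum.cong) (auto simp: A_def)
        then show ?case using elim fin_J by simp
      qed
    qed measurable
    also have "\<dots> = (\<Sum>j\<in>J. v j * b j)"
      by (subst Bochner_Integration.integral_sum) (auto simp: b_def sets_\<mu> less_top[symmetric])
    finally show ?thesis by (simp add: mult.commute)
  qed
  have b_pos: "0 < b j" if "j \<in> J" for j using that by (simp add: J_def)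
  have b_sum: "(\<Sum>j\<in>J. b j) = 1" using int_cell[of "\<lambda>_. 1"] by (simp add: \<mu>.prob_space)
  then have J_ne: "J \<noteq> {}" by auto
  have A_ne: "A j \<noteq> {}" if "j \<in> J" for j using b_pos[OF that] by (auto simp: b_def)

  \<comment> \<open>The remainder cell \<open>n\<close> need not be small, so it gets distance 0 and
    its cost is charged in \<open>c\<close> and \<open>e\<close> below.\<close>
  define D where "D = (\<lambda>j x. if j = n then 0 else infdist x (A j))"
  have D_ge_0: "0 \<le> D j x" for j x by (simp add: D_def infdist_nonneg)
  interpret hopf_lax_lsi \<mu> C J D
  proof
    show "D j y \<le> D j x + dist x y" for j x y
      using infdist_triangle[of y "A j" x] by (auto simp: D_def dist_commute)
    show "AE x in \<mu>. \<exists>j\<in>J. D j x = 0"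
      using cell_J by eventually_elim (auto simp: D_def A_def intro!: bexI[of _ "cell _"] infdist_zero)
  qed (use assms fin_J J_ne D_ge_0 in \<open>auto simp: \<mu>.emeasure_space_1\<close>)
  have D_meas[measurable]: "D j \<in> borel_measurable borel" for j
    unfolding D_def
    by (cases "j = n") (auto intro!: borel_measurable_continuous_onI continuous_intros)
  have int_a: "integrable \<nu> (\<lambda>x. (D j x)\<^sup>2)" if j: "j \<in> J" for j
  proof -
    obtain y where y: "y \<in> A j" using A_ne[OF j] by auto
    show ?thesis
    proof (rule Bochner_Integration.integrable_bound)
      show "integrable \<nu> (\<lambda>x. 2 * (d x)\<^sup>2 + 2 * (d y)\<^sup>2)" using d2\<nu> by simp
      have "(D j x)\<^sup>2 \<le> 2 * (d x)\<^sup>2 + 2 * (d y)\<^sup>2" for x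
      proof -
        have "D j x \<le> dist x y" using infdist_le[OF y, of x] by (auto simp: D_def)
        also have "\<dots> \<le> d x + d y" unfolding d_def by (metis dist_commute dist_triangle)
        finally have "(D j x)\<^sup>2 \<le> (d x + d y)\<^sup>2" using D_ge_0 by (intro power_mono)
        also have "\<dots> \<le> 2 * (d x)\<^sup>2 + 2 * (d y)\<^sup>2"
          using zero_le_power2[of "d x - d y"] by (simp add: power2_eq_square algebra_simps)
        finally show ?thesis .
      qed
      then show "AE x in \<nu>. norm ((D j x)\<^sup>2) \<le> norm (2 * (d x)\<^sup>2 + 2 * (d y)\<^sup>2)" by simp
    qed measurable
  qed
  \<comment> \<open>The integral of the step function \<open>v (cell y)\<close> under
    \<open>\<mu>\<close> is exactly the linear term of the dual functional.\<close>
  have dual: "(\<integral>x. (MIN j\<in>J. v j + (D j x)\<^sup>2) \<partial>\<nu>) - (\<Sum>j\<in>J. b j * v j) \<le> \<Lambda>" for v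
  proof -
    have "(\<integral>x. hopf_lax J D v x \<partial>\<nu>) \<le> \<Lambda> + (\<integral>y. v (cell y) \<partial>\<mu>)"
      unfolding \<Lambda>
    proof (rule integral_hopf_lax_le)
      show "AE x in \<mu>. \<exists>j\<in>J. D j x = 0 \<and> v j = v (cell x)"
        using cell_J by eventually_elim (auto simp: D_def A_def intro!: bexI[of _ "cell _"] infdist_zero)
    qed (use assms in auto)
    then show ?thesis by (simp add: int_cell hopf_lax_def)
  qed
  obtain p where p: "\<And>j. j \<in> J \<Longrightarrow> p j \<in> borel_measurable \<nu>" "\<And>j x. 0 \<le> p j x"
    "\<And>x. (\<Sum>j\<in>J. p j x) = 1" "\<And>j. j \<in> J \<Longrightarrow> (\<integral>x. p j x \<partial>\<nu>) = b j"
    and p_cost: "(\<integral>x. (\<Sum>j\<in>J. p j x * (D j x)\<^sup>2) \<partial>\<nu>) \<le> \<Lambda> + \<delta>"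
    using semidiscrete_plan[OF \<open>prob_space \<nu>\<close> fin_J J_ne b_pos b_sum int_a dual \<delta>] by blast
  have p_le_1: "p j x \<le> 1" if "j \<in> J" for j x
    using member_le_sum[of j J "\<lambda>j. p j x"] that fin_J p(2) p(3)[of x] by auto
  have int_p: "integrable \<nu> (\<lambda>x. p j x * g x)" if j: "j \<in> J" and g: "integrable \<nu> g" for j and g :: "'a \<Rightarrow> real"
  proof (rule Bochner_Integration.integrable_bound[OF g])
    show "(\<lambda>x. p j x * g x) \<in> borel_measurable \<nu>" using p(1)[OF j] g by measurable
    have "\<bar>p j x * g x\<bar> \<le> 1 * \<bar>g x\<bar>" for x
      unfolding abs_mult using p(2) p_le_1[OF j] by (intro mult_right_mono) auto
    then show "AE x in \<nu>. norm (p j x * g x) \<le> norm (g x)" by simp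
  qed
  have p_int: "integrable \<nu> (p j)" if "j \<in> J" for j using int_p[OF that, of "\<lambda>_. 1"] by simp

  \<comment> \<open>For a small cell, \<open>(D + \<delta>)\<^sup>2 \<le> (1 + \<delta>) * D\<^sup>2
    + \<delta> + \<delta>\<^sup>2\<close> by \<open>2 * D \<le> D\<^sup>2 + 1\<close>; for the
    remainder, \<open>(d x + d y)\<^sup>2 \<le> 2 * (d x)\<^sup>2 + 2 * (d
    y)\<^sup>2\<close>.\<close>
  define c where "c = (\<lambda>j x. (1 + \<delta>) * (D j x)\<^sup>2 + (\<delta> + \<delta>\<^sup>2) + (if j = n then 2 * (d x)\<^sup>2 else 0))"
  define e where "e = (\<lambda>j y. if j = n then 2 * (d y)\<^sup>2 else 0)"
  have dist_le: "(dist x y)\<^sup>2 \<le> c j x + e j y" if j: "j \<in> J" and y: "y \<in> A j" for j x y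
  proof (cases "j = n")
    case True
    have "dist x y \<le> d x + d y" unfolding d_def by (metis dist_commute dist_triangle)
    then have "(dist x y)\<^sup>2 \<le> (d x + d y)\<^sup>2" by (intro power_mono) auto
    also have "\<dots> \<le> 2 * (d x)\<^sup>2 + 2 * (d y)\<^sup>2"
      using zero_le_power2[of "d x - d y"] by (simp add: power2_eq_square algebra_simps)
    finally have "(dist x y)\<^sup>2 \<le> 2 * (d x)\<^sup>2 + 2 * (d y)\<^sup>2" .
    moreover have "0 \<le> \<delta> + \<delta>\<^sup>2" using \<delta> by simp
    ultimately show ?thesis using True by (simp add: c_def e_def D_def)
  next
    case False
    have near: "dist (z j) y' < \<delta> / 2" if "y' \<in> A j" for y'
    proof -
      have "idx y' = j" using that False by (auto simp: A_def cell_def min_def split: if_splits)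
      then show ?thesis using idx[of y'] by simp
    qed
    \<comment> \<open>Two points of the cell are both within \<open>\<delta> / 2\<close> of the
      centre \<open>z j\<close>.\<close>
    have "dist x y - \<delta> \<le> dist x y'" if "y' \<in> A j" for y'
      using dist_triangle[of x y y'] dist_triangle3[of y' y "z j"] near[OF y] near[OF that] by simp
    then have "dist x y - \<delta> \<le> infdist x (A j)"
      unfolding infdist_def using A_ne[OF j] by (auto intro: cINF_greatest)
    then have "dist x y \<le> D j x + \<delta>" using False by (simp add: D_def)
    then have "(dist x y)\<^sup>2 \<le> (D j x + \<delta>)\<^sup>2" by (intro power_mono) auto
    also have "\<dots> = (D j x)\<^sup>2 + \<delta> * (2 * D j x) + \<delta>\<^sup>2" by (simp add: power2_eq_square algebra_simps)
    also have "\<delta> * (2 * D j x) \<le> \<delta> * ((D j x)\<^sup>2 + 1)"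
      using \<delta> zero_le_power2[of "D j x - 1"] by (intro mult_left_mono) (auto simp: power2_eq_square algebra_simps)
    finally show ?thesis using False by (simp add: c_def e_def algebra_simps)
  qed
  have c_nonneg: "0 \<le> c j x" and e_nonneg: "0 \<le> e j x" for j x
    using \<delta> by (auto simp: c_def e_def)
  have "W2sq \<nu> \<mu> \<le> (\<Sum>j\<in>J. (\<integral>\<^sup>+x. ennreal (p j x * c j x) \<partial>\<nu>) + (\<integral>\<^sup>+y. ennreal (e j y) * indicator (A j) y \<partial>\<mu>))"
  proof (rule W2sq_le_plan[where A = A])
    show "disjoint_family_on A J" by (auto simp: disjoint_family_on_def A_def)
    show "AE y in \<mu>. y \<in> (\<Union>j\<in>J. A j)" using cell_J by eventually_elim (simp add: A_def)
    show "c j \<in> borel_measurable borel" for j unfolding c_def by (cases "j = n") simp_all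
    show "e j \<in> borel_measurable borel" for j unfolding e_def by (cases "j = n") simp_all
  qed (use assms fin_J p b_pos c_nonneg e_nonneg dist_le in \<open>auto simp: b_def\<close>)
  \<comment> \<open>The extra cost of the remainder cell on both sides.\<close>
  also define X where "X = 2 * (\<integral>x. p n x * (d x)\<^sup>2 \<partial>\<nu>) + 2 * (\<integral>y. (d y)\<^sup>2 * indicator (A n) y \<partial>\<mu>)"
  have d2A: "integrable \<mu> (\<lambda>y. (d y)\<^sup>2 * indicator (A j) y)" for j
    using integrable_mult_indicator[OF _ d2\<mu>, of "A j"] by (simp add: sets_\<mu> mult.commute)
  have "(\<integral>\<^sup>+x. ennreal (p j x * c j x) \<partial>\<nu>) + (\<integral>\<^sup>+y. ennreal (e j y) * indicator (A j) y \<partial>\<mu>)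
      = ennreal ((1 + \<delta>) * (\<integral>x. p j x * (D j x)\<^sup>2 \<partial>\<nu>) + (\<delta> + \<delta>\<^sup>2) * b j + (if j = n then X else 0))"
    if j: "j \<in> J" for j
  proof -
    have int_c: "integrable \<nu> (\<lambda>x. p j x * c j x)"
      unfolding c_def using int_a[OF j] d2\<nu>
      by (intro int_p[OF j] Bochner_Integration.integrable_add) (cases "j = n"; simp)+
    have int_e: "integrable \<mu> (\<lambda>y. e j y * indicator (A j) y)"
      using d2A[of j] by (cases "j = n") (simp_all add: e_def mult.assoc)
    have pc: "(\<integral>x. p j x * c j x \<partial>\<nu>) = (1 + \<delta>) * (\<integral>x. p j x * (D j x)\<^sup>2 \<partial>\<nu>) + (\<delta> + \<delta>\<^sup>2) * b j
      + (if j = n then 2 * (\<integral>x. p j x * (d x)\<^sup>2 \<partial>\<nu>) else 0)"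
    proof -
      have "(\<integral>x. p j x * c j x \<partial>\<nu>) = (\<integral>x. (1 + \<delta>) * (p j x * (D j x)\<^sup>2) + (\<delta> + \<delta>\<^sup>2) * p j x
        + (if j = n then 2 else 0) * (p j x * (d x)\<^sup>2) \<partial>\<nu>)"
        by (intro Bochner_Integration.integral_cong) (auto simp: c_def algebra_simps)
      also have "\<dots> = (1 + \<delta>) * (\<integral>x. p j x * (D j x)\<^sup>2 \<partial>\<nu>) + (\<delta> + \<delta>\<^sup>2) * (\<integral>x. p j x \<partial>\<nu>)
        + (if j = n then 2 else 0) * (\<integral>x. p j x * (d x)\<^sup>2 \<partial>\<nu>)"
        using int_p[OF j int_a[OF j]] int_p[OF j d2\<nu>] p_int[OF j] by simp
      finally show ?thesis using p(4)[OF j] by auto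
    qed
    have "(\<integral>\<^sup>+x. ennreal (p j x * c j x) \<partial>\<nu>) = ennreal (\<integral>x. p j x * c j x \<partial>\<nu>)"
      using int_c p(2) c_nonneg by (intro nn_integral_eq_integral) auto
    moreover have "(\<integral>\<^sup>+y. ennreal (e j y) * indicator (A j) y \<partial>\<mu>) = (\<integral>\<^sup>+y. ennreal (e j y * indicator (A j) y) \<partial>\<mu>)"
      by (intro nn_integral_cong) (auto split: split_indicator)
    moreover have "\<dots> = ennreal (\<integral>y. e j y * indicator (A j) y \<partial>\<mu>)"
      using int_e e_nonneg by (intro nn_integral_eq_integral) auto
    moreover have "(\<integral>y. e j y * indicator (A j) y \<partial>\<mu>) = (if j = n then 2 * (\<integral>y. (d y)\<^sup>2 * indicator (A n) y \<partial>\<mu>) else 0)"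
      by (cases "j = n") (simp_all add: e_def mult.assoc)
    moreover have "0 \<le> (\<integral>x. p j x * c j x \<partial>\<nu>)" "0 \<le> (\<integral>y. e j y * indicator (A j) y \<partial>\<mu>)"
      using p(2) c_nonneg e_nonneg by (auto intro!: integral_nonneg_AE)
    ultimately show ?thesis by (simp add: pc X_def add.assoc flip: ennreal_plus)
  qed
  then have "(\<Sum>j\<in>J. (\<integral>\<^sup>+x. ennreal (p j x * c j x) \<partial>\<nu>) + (\<integral>\<^sup>+y. ennreal (e j y) * indicator (A j) y \<partial>\<mu>))
    = (\<Sum>j\<in>J. ennreal ((1 + \<delta>) * (\<integral>x. p j x * (D j x)\<^sup>2 \<partial>\<nu>) + (\<delta> + \<delta>\<^sup>2) * b j + (if j = n then X else 0)))"
    by (rule sum.cong[OF refl])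
  also have "\<dots> = ennreal (\<Sum>j\<in>J. (1 + \<delta>) * (\<integral>x. p j x * (D j x)\<^sup>2 \<partial>\<nu>) + (\<delta> + \<delta>\<^sup>2) * b j + (if j = n then X else 0))"
  proof (rule sum_ennreal)
    fix j assume j: "j \<in> J"
    have "0 \<le> X" unfolding X_def using p(2) by (auto intro!: add_nonneg_nonneg integral_nonneg_AE)
    moreover have "0 \<le> (\<integral>x. p j x * (D j x)\<^sup>2 \<partial>\<nu>)" using p(2) by (auto intro!: integral_nonneg_AE)
    ultimately show "0 \<le> (1 + \<delta>) * (\<integral>x. p j x * (D j x)\<^sup>2 \<partial>\<nu>) + (\<delta> + \<delta>\<^sup>2) * b j + (if j = n then X else 0)"
      using \<delta> b_pos[OF j] by auto
  qed
  also have "\<dots> \<le> ennreal ((1 + \<delta>) * (\<Lambda> + \<delta>) + (\<delta> + \<delta>\<^sup>2) + 4 * \<delta>)"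
  proof (rule ennreal_leI)
    \<comment> \<open>On \<open>d x < M\<close> the mass sent to cell \<open>n\<close> costs at most
      \<open>M\<^sup>2 * b n\<close>, and beyond it at most the tail of \<open>\<nu>\<close>. The
      choice of \<open>n\<close> bounds \<open>M\<^sup>2 * b n\<close> together with the
      \<open>\<mu>\<close>-part by \<open>\<delta>\<close>; the factor 2 in \<open>X\<close> gives
      \<open>4 * \<delta>\<close>.\<close>
    have "(if n \<in> J then X else 0) \<le> 4 * \<delta>"
    proof (cases "n \<in> J")
      case True
      have "(\<integral>x. p n x * (d x)\<^sup>2 \<partial>\<nu>) \<le> (\<integral>x. M\<^sup>2 * p n x + tail x \<partial>\<nu>)"
      proof (rule integral_mono)
        show "p n x * (d x)\<^sup>2 \<le> M\<^sup>2 * p n x + tail x" for x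
        proof (cases "M \<le> d x")
          case True
          have "p n x * (d x)\<^sup>2 \<le> 1 * (d x)\<^sup>2" using p_le_1[OF \<open>n \<in> J\<close>] by (intro mult_right_mono) auto
          then show ?thesis using True p(2)[of n x] by (simp add: tail_def add_increasing)
        next
          case False
          then have "(d x)\<^sup>2 \<le> M\<^sup>2" by (intro power_mono) (auto simp: d_def)
          then show ?thesis using False p(2)[of n x] by (simp add: tail_def mult.commute mult_left_mono)
        qed
      qed (use int_p[OF True d2\<nu>] p_int[OF True] int_tail in auto)
      also have "\<dots> = M\<^sup>2 * b n + (\<integral>x. tail x \<partial>\<nu>)" using p_int[OF True] int_tail p(4)[OF True] by simp
      finally have *: "(\<integral>x. p n x * (d x)\<^sup>2 \<partial>\<nu>) \<le> M\<^sup>2 * b n + \<delta>" using tail by simp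
      have An: "A n = {y. n \<le> idx y}" by (auto simp: A_def cell_def)
      have "(\<integral>y. ((d y)\<^sup>2 + M\<^sup>2) * indicator (A n) y \<partial>\<mu>) = (\<integral>y. (d y)\<^sup>2 * indicator (A n) y + M\<^sup>2 * indicator (A n) y \<partial>\<mu>)"
        by (simp add: distrib_right)
      also have "\<dots> = (\<integral>y. (d y)\<^sup>2 * indicator (A n) y \<partial>\<mu>) + M\<^sup>2 * b n"
        using d2A[of n] by (subst Bochner_Integration.integral_add) (auto simp: b_def sets_\<mu> less_top[symmetric])
      finally have "(\<integral>y. (d y)\<^sup>2 * indicator (A n) y \<partial>\<mu>) + M\<^sup>2 * b n < \<delta>" using n by (simp add: An)
      then show ?thesis using True * by (simp add: X_def)
    qed (use \<delta> in auto)
    moreover have "(\<Sum>j\<in>J. (1 + \<delta>) * (\<integral>x. p j x * (D j x)\<^sup>2 \<partial>\<nu>)) \<le> (1 + \<delta>) * (\<Lambda> + \<delta>)"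
    proof -
      have "(\<Sum>j\<in>J. \<integral>x. p j x * (D j x)\<^sup>2 \<partial>\<nu>) \<le> \<Lambda> + \<delta>"
        using p_cost int_p int_a by (subst (asm) Bochner_Integration.integral_sum) auto
      then show ?thesis unfolding sum_distrib_left[symmetric] using \<delta> by (intro mult_left_mono) auto
    qed
    moreover have "(\<Sum>j\<in>J. (\<delta> + \<delta>\<^sup>2) * b j) = \<delta> + \<delta>\<^sup>2"
      by (simp add: b_sum flip: sum_distrib_left)
    moreover have "(\<Sum>j\<in>J. if j = n then X else 0) = (if n \<in> J then X else 0)"
      using fin_J by simp
    ultimately show "(\<Sum>j\<in>J. (1 + \<delta>) * (\<integral>x. p j x * (D j x)\<^sup>2 \<partial>\<nu>) + (\<delta> + \<delta>\<^sup>2) * b j + (if j = n then X else 0))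
      \<le> (1 + \<delta>) * (\<Lambda> + \<delta>) + (\<delta> + \<delta>\<^sup>2) + 4 * \<delta>"
      by (simp add: sum.distrib)
  qed
  finally show ?thesis .
qed

theorem theorem3p5:
  fixes \<mu> :: "'a::polish_space measure" and C :: real
  assumes "C > 0"
    and "P2 \<mu>"
    and "LSI_plus \<mu> C"
  shows "T2 \<mu> C"
  unfolding T2_def
proof (intro allI impI, elim conjE)
  fix \<nu> :: "'a measure" assume \<nu>: "prob_space \<nu>" "sets \<nu> = sets borel"
  obtain x0 where \<mu>: "prob_space \<mu>" "sets \<mu> = sets borel"
    and "(\<integral>\<^sup>+ x. ennreal ((dist x0 x)\<^sup>2) \<partial>\<mu>) < \<infinity>"
    using assms(2) by (auto simp: P2_def)
  then have int: "integrable \<mu> (\<lambda>x. (dist x0 x)\<^sup>2)"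
    by (intro integrableI_bounded) (auto simp: measurable_cong_sets[OF \<mu>(2) refl])
  show "W2sq \<nu> \<mu> \<le> ennreal C * rel_entropy \<nu> \<mu>"
  proof (cases "absolutely_continuous \<mu> \<nu> \<and> integrable \<nu> (\<lambda>x. ln (enn2real (RN_deriv \<mu> \<nu> x)))")
    case False
    \<comment> \<open>Positivity of \<open>C\<close> matters: in \<open>ennreal\<close> the product
      of 0 and infinity is 0.\<close>
    then have "rel_entropy \<nu> \<mu> = \<infinity>" by (simp only: rel_entropy_def if_False)
    then show ?thesis using assms(1) by (simp add: ennreal_mult_top)
  next
    case True
    define \<Lambda> where "\<Lambda> = C * (\<integral>x. ln (enn2real (RN_deriv \<mu> \<nu> x)) \<partial>\<nu>)"
    have ent: "ennreal C * rel_entropy \<nu> \<mu> = ennreal \<Lambda>"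
      using True assms(1) by (simp add: rel_entropy_def \<Lambda>_def ennreal_mult')
    \<comment> \<open>As \<open>\<delta>\<close> tends to 0 from the right, the approximate bound
      becomes \<open>ennreal \<Lambda>\<close>.\<close>
    have "((\<lambda>\<delta>. ennreal ((1 + \<delta>) * (\<Lambda> + \<delta>) + (\<delta> + \<delta>\<^sup>2) + 4 * \<delta>)) \<longlongrightarrow>
        ennreal ((1 + 0) * (\<Lambda> + 0) + (0 + 0\<^sup>2) + 4 * 0)) (at_right 0)"
      by (intro tendsto_intros)
    moreover have "eventually (\<lambda>\<delta>. W2sq \<nu> \<mu> \<le> ennreal ((1 + \<delta>) * (\<Lambda> + \<delta>) + (\<delta> + \<delta>\<^sup>2) + 4 * \<delta>)) (at_right 0)"
      using eventually_at_right_less[of "0::real"]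
    proof eventually_elim
      case (elim \<delta>)
      then show ?case
        using W2sq_le_entropy_approx[OF \<mu> assms(1,3) int \<nu> _ _ \<Lambda>_def] True by blast
    qed
    ultimately show ?thesis
      unfolding ent using tendsto_lowerbound by fastforce
  qed
qed

end
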